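(* Let $(X,b,m)$ be a weighted graph, $c\colon X\to[0,\infty)$, $E$ a Hermitian vector bundle over $X$ with unitary connection $\Phi$, and $W$ a pointwise positive bundle endomorphism of $E$. Assume that $W(x)\ge c(x)\,\mathrm{id}_x$ in the sense of quadratic forms on $E_x$ for all $x\in X$. If $Q^{(D)}_{b,c}=Q^{(N)}_{b,c}$, then $Q^{(D)}_{\Phi,b,W}=Q^{(N)}_{\Phi,b,W}$.
   Context: A weighted graph $(X,b,m)$ consists of an at most countable set $X$ (with the discrete topology), an edge weight $b\colon X\times X\to[0,\infty)$ with $b(x,x)=0$, $b(x,y)=b(y,x)$ and $\sum_{y\in X}b(x,y)<\infty$ for all $x,y\in X$, and a function $m\colon X\to(0,\infty)$, regarded as a measure on all subsets of $X$ by $m(A)=\sum_{x\in A}m(x)$. (Local finiteness is not assumed.) A Hermitian vector bundle $E$ over the discrete space $X$ is a family $(E_x)_{x\in X}$ of isometrically isomorphic finite-dimensional complex Hilbert spaces. A unitary connection on $E$ is a family $\Phi=(\Phi_{x,y})_{x,y\in X}$ of unitary maps $\Phi_{x,y}\colon E_y\to E_x$ with $\Phi_{x,y}=\Phi_{y,x}^{-1}$. A bundle endomorphism $W$ is a family of linear maps $W(x)\colon E_x\to E_x$; it is pointwise positive if $\langle W(x)v,v\rangle_x\ge0$ for all $x\in X$, $v\in E_x$. $\Gamma(X;E)$ is the space of all sections (maps $u$ with $u(x)\in E_x$), $\Gamma_c(X;E)$ the sections with finite support, and $\ell^2(X,m;E)$ the Hilbert space of sections with $\sum_x|u(x)|_x^2m(x)<\infty$,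 with inner product $\langle u,v\rangle=\sum_x\langle u(x),v(x)\rangle_xm(x)$. For $u\in\Gamma(X;E)$ let $$\tilde Q_{\Phi,b,W}(u)=\frac12\sum_{x,y}b(x,y)|u(x)-\Phi_{x,y}u(y)|_x^2+\sum_x\langle W(x)u(x),u(x)\rangle_x\in[0,\infty].$$ The magnetic form with Neumann boundary conditions $Q^{(N)}_{\Phi,b,W}$ is the restriction of $\tilde Q_{\Phi,b,W}$ to $D(Q^{(N)}_{\Phi,b,W})=\{u\in\ell^2(X,m;E):\tilde Q_{\Phi,b,W}(u)<\infty\}$; it is closed. The magnetic form with Dirichlet boundary conditions $Q^{(D)}_{\Phi,b,W}$ is the closure of the restriction of $Q^{(N)}_{\Phi,b,W}$ to $\Gamma_c(X;E)$ (with respect to the form norm $(Q^{(N)}_{\Phi,b,W}(u)+\|u\|^2)^{1/2}$). When $E_x=\mathbb{C}$, $\Phi_{x,y}=1$ for all $x,y$ and $W$ is multiplication by $c\colon X\to[0,\infty)$, these forms are denoted $Q^{(N)}_{b,c}$ and $Q^{(D)}_{b,c}$. Equality of forms includes equality of domains. *)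

theory Defs
  imports
    "HOL-Analysis.Analysis"
    "HOL-Library.Complex_Order"
    "HOL-Algebra.Module"
begin

section \<open>Weighted graphs\<close>

text \<open>Local finiteness is not assumed; only the weights at each vertex are summable.\<close>

locale weighted_graph =
  fixes X :: "'x set" and b :: "'x \<Rightarrow> 'x \<Rightarrow> real" and m :: "'x \<Rightarrow> real"
  assumes countable_vertices: "countable X"
    and edge_nonneg: "\<And>x y. x \<in> X \<Longrightarrow> y \<in> X \<Longrightarrow> 0 \<le> b x y"
    and edge_diag: "\<And>x. x \<in> X \<Longrightarrow> b x x = 0"
    and edge_sym: "\<And>x y. x \<in> X \<Longrightarrow> y \<in> X \<Longrightarrow> b x y = b y x"
    and edge_summable: "\<And>x. x \<in> X \<Longrightarrow> b x summable_on X"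
    and measure_pos: "\<And>x. x \<in> X \<Longrightarrow> 0 < m x"

section \<open>Finite-dimensional complex Hilbert spaces\<close>

text \<open>
  The fibres of a bundle are different spaces, so a Hilbert space is an explicit structure with a
  carrier rather than a type. The fields \<open>mult\<close> and \<open>one\<close> inherited from the
  ring record play no role.
\<close>

definition complex_ring :: "complex ring" where
  "complex_ring = \<lparr>carrier = UNIV, mult = (*), one = 1, zero = 0, add = (+)\<rparr>"

record 'v cinner_space = "(complex, 'v) module" +
  cinner :: "'v \<Rightarrow> 'v \<Rightarrow> complex"

text \<open>
  The inner product is linear in its first argument. Completeness is automatic in finite dimension.
\<close>

locale fd_hilbert = Module.module complex_ring V
  for V :: "'v cinner_space" (structure) +
  assumes cinner_add_left:
      "\<And>u v w. u \<in> carrier V \<Longrightarrow> v \<in> carrier V \<Longrightarrow> w \<in> carrier V \<Longrightarrow>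
        cinner V (u \<oplus> v) w = cinner V u w + cinner V v w"
    and cinner_scale_left:
      "\<And>a u v. u \<in> carrier V \<Longrightarrow> v \<in> carrier V \<Longrightarrow> cinner V (a \<odot> u) v = a * cinner V u v"
    and cinner_commute:
      "\<And>u v. u \<in> carrier V \<Longrightarrow> v \<in> carrier V \<Longrightarrow> cinner V u v = cnj (cinner V v u)"
    and cinner_nonneg: "\<And>u. u \<in> carrier V \<Longrightarrow> 0 \<le> cinner V u u"
    and cinner_definite: "\<And>u. u \<in> carrier V \<Longrightarrow> cinner V u u = 0 \<Longrightarrow> u = \<zero>"
    and finite_dimensional:
      "\<exists>B. finite B \<and> B \<subseteq> carrier V \<and>
         (\<forall>v\<in>carrier V. \<exists>a. v = finsum V (\<lambda>e. a e \<odot> e) B)"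

definition cnorm :: "'v cinner_space \<Rightarrow> 'v \<Rightarrow> real" where
  "cnorm V v = sqrt (Re (cinner V v v))"

definition linear_between ::
  "'v cinner_space \<Rightarrow> 'w cinner_space \<Rightarrow> ('v \<Rightarrow> 'w) \<Rightarrow> bool" where
  "linear_between V W T \<longleftrightarrow>
     T \<in> carrier V \<rightarrow> carrier W \<and>
     (\<forall>u\<in>carrier V. \<forall>v\<in>carrier V. T (u \<oplus>\<^bsub>V\<^esub> v) = T u \<oplus>\<^bsub>W\<^esub> T v) \<and>
     (\<forall>a. \<forall>v\<in>carrier V. T (a \<odot>\<^bsub>V\<^esub> v) = a \<odot>\<^bsub>W\<^esub> T v)"

definition unitary_between ::
  "'v cinner_space \<Rightarrow> 'w cinner_space \<Rightarrow> ('v \<Rightarrow> 'w) \<Rightarrow> bool" where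
  "unitary_between V W T \<longleftrightarrow>
     linear_between V W T \<and> bij_betw T (carrier V) (carrier W) \<and>
     (\<forall>u\<in>carrier V. \<forall>v\<in>carrier V. cinner W (T u) (T v) = cinner V u v)"

definition complex_line :: "complex cinner_space" where
  "complex_line =
     \<lparr>carrier = UNIV, mult = (*), one = 1, zero = 0, add = (+), smult = (*),
      cinner = (\<lambda>z w. z * cnj w)\<rparr>"

section \<open>Bundles, connections, endomorphisms\<close>

definition hermitian_bundle :: "'x set \<Rightarrow> ('x \<Rightarrow> 'v cinner_space) \<Rightarrow> bool" where
  "hermitian_bundle X E \<longleftrightarrow>
     (\<forall>x\<in>X. fd_hilbert (E x)) \<and> (\<forall>x\<in>X. \<forall>y\<in>X. \<exists>T. unitary_between (E x) (E y) T)"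

text \<open>The map \<open>\<Phi> x y\<close> goes from the fibre over \<open>y\<close> to the fibre over \<open>x\<close>.\<close>

definition unitary_connection ::
  "'x set \<Rightarrow> ('x \<Rightarrow> 'v cinner_space) \<Rightarrow> ('x \<Rightarrow> 'x \<Rightarrow> 'v \<Rightarrow> 'v) \<Rightarrow> bool" where
  "unitary_connection X E \<Phi> \<longleftrightarrow>
     (\<forall>x\<in>X. \<forall>y\<in>X. unitary_between (E y) (E x) (\<Phi> x y)) \<and>
     (\<forall>x\<in>X. \<forall>y\<in>X. \<forall>v\<in>carrier (E x). \<Phi> x y (\<Phi> y x v) = v)"

definition bundle_endomorphism ::
  "'x set \<Rightarrow> ('x \<Rightarrow> 'v cinner_space) \<Rightarrow> ('x \<Rightarrow> 'v \<Rightarrow> 'v) \<Rightarrow> bool" where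
  "bundle_endomorphism X E W \<longleftrightarrow> (\<forall>x\<in>X. linear_between (E x) (E x) (W x))"

text \<open>
  Inequalities between complex numbers are those of \<open>Complex_Order\<close>; in particular
  \<open>0 \<le> z\<close> includes that \<open>z\<close> is real.
\<close>

definition pointwise_positive ::
  "'x set \<Rightarrow> ('x \<Rightarrow> 'v cinner_space) \<Rightarrow> ('x \<Rightarrow> 'v \<Rightarrow> 'v) \<Rightarrow> bool" where
  "pointwise_positive X E W \<longleftrightarrow>
     (\<forall>x\<in>X. \<forall>v\<in>carrier (E x). 0 \<le> cinner (E x) (W x v) v)"

definition bounded_below_by ::
  "'x set \<Rightarrow> ('x \<Rightarrow> 'v cinner_space) \<Rightarrow> ('x \<Rightarrow> 'v \<Rightarrow> 'v) \<Rightarrow> ('x \<Rightarrow> real) \<Rightarrow> bool" where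
  "bounded_below_by X E W c \<longleftrightarrow>
     (\<forall>x\<in>X. \<forall>v\<in>carrier (E x).
        cinner (E x) (complex_of_real (c x) \<odot>\<^bsub>E x\<^esub> v) v \<le> cinner (E x) (W x v) v)"

section \<open>Sections\<close>

text \<open>Sections are extensional functions, so that they are determined by their values on \<open>X\<close>.\<close>

definition sections :: "'x set \<Rightarrow> ('x \<Rightarrow> 'v cinner_space) \<Rightarrow> ('x \<Rightarrow> 'v) set" where
  "sections X E = (\<Pi>\<^sub>E x\<in>X. carrier (E x))"

definition fin_sections :: "'x set \<Rightarrow> ('x \<Rightarrow> 'v cinner_space) \<Rightarrow> ('x \<Rightarrow> 'v) set" where
  "fin_sections X E = {u \<in> sections X E. finite {x \<in> X. u x \<noteq> \<zero>\<^bsub>E x\<^esub>}}"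

definition l2_sections ::
  "'x set \<Rightarrow> ('x \<Rightarrow> real) \<Rightarrow> ('x \<Rightarrow> 'v cinner_space) \<Rightarrow> ('x \<Rightarrow> 'v) set" where
  "l2_sections X m E = {u \<in> sections X E. (\<lambda>x. (cnorm (E x) (u x))\<^sup>2 * m x) summable_on X}"

definition l2_norm ::
  "'x set \<Rightarrow> ('x \<Rightarrow> real) \<Rightarrow> ('x \<Rightarrow> 'v cinner_space) \<Rightarrow> ('x \<Rightarrow> 'v) \<Rightarrow> real" where
  "l2_norm X m E u = sqrt (\<Sum>\<^sub>\<infinity>x\<in>X. (cnorm (E x) (u x))\<^sup>2 * m x)"

definition section_diff ::
  "'x set \<Rightarrow> ('x \<Rightarrow> 'v cinner_space) \<Rightarrow> ('x \<Rightarrow> 'v) \<Rightarrow> ('x \<Rightarrow> 'v) \<Rightarrow> 'x \<Rightarrow> 'v" where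
  "section_diff X E u v = (\<lambda>x\<in>X. u x \<ominus>\<^bsub>E x\<^esub> v x)"

section \<open>Quadratic forms and their closures\<close>

text \<open>
  A quadratic form on \<open>l2_sections X m E\<close> is a partial real-valued function \<open>q\<close> whose
  domain of definition is \<open>dom q\<close>. Equality of such partial functions is equality of the
  domains together with equality of the values.
\<close>

type_synonym ('x, 'v) qform = "('x \<Rightarrow> 'v) \<rightharpoonup> real"

definition form_norm ::
  "'x set \<Rightarrow> ('x \<Rightarrow> real) \<Rightarrow> ('x \<Rightarrow> 'v cinner_space) \<Rightarrow> ('x, 'v) qform \<Rightarrow> ('x \<Rightarrow> 'v) \<Rightarrow> real" where
  "form_norm X m E q u = sqrt (the (q u) + (l2_norm X m E u)\<^sup>2)"

definition form_approximates ::
  "'x set \<Rightarrow> ('x \<Rightarrow> real) \<Rightarrow> ('x \<Rightarrow> 'v cinner_space) \<Rightarrow> ('x, 'v) qform \<Rightarrow>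
    (nat \<Rightarrow> 'x \<Rightarrow> 'v) \<Rightarrow> ('x \<Rightarrow> 'v) \<Rightarrow> bool" where
  "form_approximates X m E q f u \<longleftrightarrow>
     (\<forall>n. f n \<in> dom q) \<and>
     (\<forall>\<epsilon>>0. \<exists>N. \<forall>i\<ge>N. \<forall>j\<ge>N. form_norm X m E q (section_diff X E (f i) (f j)) < \<epsilon>) \<and>
     (\<lambda>n. l2_norm X m E (section_diff X E (f n) u)) \<longlonglongrightarrow> 0"

text \<open>
  The closure of a closable form: its domain consists of the \<open>\<ell>\<^sup>2\<close>-limits of
  form-Cauchy sequences from the domain of \<open>q\<close>, and its value at such a limit is the limit of the
  values of \<open>q\<close> along any such sequence. For a closable form (in particular for every
  restriction of a closed form to a subspace) the latter limit exists and does not depend on the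
  sequence, so the definite description is proper.
\<close>

definition form_closure ::
  "'x set \<Rightarrow> ('x \<Rightarrow> real) \<Rightarrow> ('x \<Rightarrow> 'v cinner_space) \<Rightarrow> ('x, 'v) qform \<Rightarrow> ('x, 'v) qform" where
  "form_closure X m E q = (\<lambda>u.
     if u \<in> l2_sections X m E \<and> (\<exists>f. form_approximates X m E q f u)
     then Some (THE r. \<forall>f. form_approximates X m E q f u \<longrightarrow> (\<lambda>n. the (q (f n))) \<longlonglongrightarrow> r)
     else None)"

section \<open>Magnetic forms\<close>

definition magnetic_energy ::
  "'x set \<Rightarrow> ('x \<Rightarrow> 'x \<Rightarrow> real) \<Rightarrow> ('x \<Rightarrow> 'v cinner_space) \<Rightarrow> ('x \<Rightarrow> 'x \<Rightarrow> 'v \<Rightarrow> 'v) \<Rightarrow>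
    ('x \<Rightarrow> 'v \<Rightarrow> 'v) \<Rightarrow> ('x \<Rightarrow> 'v) \<Rightarrow> ennreal" where
  "magnetic_energy X b E \<Phi> W u =
     ennreal (1/2) * (\<Sum>\<^sub>\<infinity>(x, y)\<in>X \<times> X. ennreal (b x y * (cnorm (E x) (u x \<ominus>\<^bsub>E x\<^esub> \<Phi> x y (u y)))\<^sup>2))
     + (\<Sum>\<^sub>\<infinity>x\<in>X. ennreal (Re (cinner (E x) (W x (u x)) (u x))))"

definition neumann_form ::
  "'x set \<Rightarrow> ('x \<Rightarrow> 'x \<Rightarrow> real) \<Rightarrow> ('x \<Rightarrow> real) \<Rightarrow> ('x \<Rightarrow> 'v cinner_space) \<Rightarrow>
    ('x \<Rightarrow> 'x \<Rightarrow> 'v \<Rightarrow> 'v) \<Rightarrow> ('x \<Rightarrow> 'v \<Rightarrow> 'v) \<Rightarrow> ('x, 'v) qform" where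
  "neumann_form X b m E \<Phi> W = (\<lambda>u.
     if u \<in> l2_sections X m E \<and> magnetic_energy X b E \<Phi> W u < \<infinity>
     then Some (enn2real (magnetic_energy X b E \<Phi> W u)) else None)"

definition dirichlet_form ::
  "'x set \<Rightarrow> ('x \<Rightarrow> 'x \<Rightarrow> real) \<Rightarrow> ('x \<Rightarrow> real) \<Rightarrow> ('x \<Rightarrow> 'v cinner_space) \<Rightarrow>
    ('x \<Rightarrow> 'x \<Rightarrow> 'v \<Rightarrow> 'v) \<Rightarrow> ('x \<Rightarrow> 'v \<Rightarrow> 'v) \<Rightarrow> ('x, 'v) qform" where
  "dirichlet_form X b m E \<Phi> W =
     form_closure X m E (neumann_form X b m E \<Phi> W |` fin_sections X E)"

text \<open>
  The scalar forms are the magnetic forms of the trivial line bundle with the trivial connection;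
  their sections are complex-valued functions.
\<close>

definition scalar_neumann_form ::
  "'x set \<Rightarrow> ('x \<Rightarrow> 'x \<Rightarrow> real) \<Rightarrow> ('x \<Rightarrow> real) \<Rightarrow> ('x \<Rightarrow> real) \<Rightarrow> ('x, complex) qform" where
  "scalar_neumann_form X b m c =
     neumann_form X b m (\<lambda>_. complex_line) (\<lambda>_ _ z. z) (\<lambda>x z. complex_of_real (c x) * z)"

definition scalar_dirichlet_form ::
  "'x set \<Rightarrow> ('x \<Rightarrow> 'x \<Rightarrow> real) \<Rightarrow> ('x \<Rightarrow> real) \<Rightarrow> ('x \<Rightarrow> real) \<Rightarrow> ('x, complex) qform" where
  "scalar_dirichlet_form X b m c =
     dirichlet_form X b m (\<lambda>_. complex_line) (\<lambda>_ _ z. z) (\<lambda>x z. complex_of_real (c x) * z)"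

end

theory Submission
  imports Defs
begin

text \<open>
  Since the Neumann form is closed, the Dirichlet form is its restriction to those sections that
  are form-norm limits of finitely supported ones. So the claim is that every section \<open>u\<close> of
  finite energy can be approximated in this way (lemma \<open>dirichlet_eq_neumann_iff\<close>).

  By Kato's inequality \<open>||u x| - |u y|| \<le> |u x - \<Phi> x y (u y)|\<close> and by \<open>c \<le> W\<close>, the
  modulus \<open>|u|\<close> has finite scalar energy (lemma \<open>modulus_component_le\<close>). By hypothesis it is a limit
  of finitely supported functions \<open>\<phi> k\<close>. These are used as cutoffs: \<open>u\<close> is multiplied by
  \<open>Re (\<phi> k) / |u|\<close>, truncated to values between \<open>0\<close> and \<open>1\<close>. The estimate
  \<open>|s p - t q| \<le> |s |p| - t |q|| + |p - q|\<close> for \<open>s * t \<le> 1\<close> (lemma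
  \<open>cnorm_smult_diff_le\<close>), with \<open>p = u x\<close> and \<open>q = \<Phi> x y (u y)\<close>, separates the scalar variation of the
  error from the rotation of \<open>u\<close>. The former is controlled by the scalar energy of \<open>\<phi> k - |u|\<close>
  up to a multiple of the energy density of \<open>u\<close>, so the error tends to zero by dominated
  convergence (lemma \<open>approximable_if_scalar_forms_agree\<close>).

  Throughout, the energy is treated as the squared \<open>\<ell>\<^sup>2\<close> norm of a family of seminorms, one for
  each pair of vertices and one for each vertex. Closedness is then the Fatou lemma for square
  sums (lemma \<open>form_limit\<close>). It needs lower semicontinuity of the seminorms under pointwise
  convergence, which for \<open>v \<mapsto> sqrt \<langle>W v, v\<rangle>\<close> follows from the symmetry of a positive operator
  (lemma \<open>gauge_lower_semicontinuous\<close>).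
\<close>

section \<open>Square-summable families\<close>

definition square_summable :: "'i set \<Rightarrow> ('i \<Rightarrow> real) \<Rightarrow> bool" where
  "square_summable I p \<longleftrightarrow> (\<lambda>i. (p i)\<^sup>2) summable_on I"

definition square_norm :: "'i set \<Rightarrow> ('i \<Rightarrow> real) \<Rightarrow> real" where
  "square_norm I p = sqrt (\<Sum>\<^sub>\<infinity>i\<in>I. (p i)\<^sup>2)"

lemma square_norm_nonneg [simp]: "0 \<le> square_norm I p"
  by (simp add: square_norm_def infsum_nonneg)

lemma square_norm_squared: "(square_norm I p)\<^sup>2 = (\<Sum>\<^sub>\<infinity>i\<in>I. (p i)\<^sup>2)"
  by (simp add: square_norm_def infsum_nonneg)

lemma L2_set_le_square_norm:
  assumes "square_summable I p" "finite F" "F \<subseteq> I"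
  shows "L2_set p F \<le> square_norm I p"
  unfolding L2_set_def square_norm_def
  using assms by (intro real_sqrt_le_mono finite_sum_le_infsum) (auto simp: square_summable_def)

text \<open>
  Square sums are controlled by their finite parts, so estimates for infinite families reduce to
  estimates for finite ones.
\<close>

lemma square_norm_le_if_finite_parts:
  assumes "\<And>F. finite F \<Longrightarrow> F \<subseteq> I \<Longrightarrow> L2_set p F \<le> B"
  shows "square_summable I p" "square_norm I p \<le> B"
proof -
  have B: "0 \<le> B"
    using assms[of "{}"] by simp
  have sum_le: "(\<Sum>i\<in>F. (p i)\<^sup>2) \<le> B\<^sup>2" if "finite F" "F \<subseteq> I" for F
    using assms[OF that] B by (simp add: L2_set_def real_sqrt_le_iff' sum_nonneg)
  show summable: "square_summable I p"
    unfolding square_summable_def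
    by (rule nonneg_bdd_above_summable_on) (auto intro!: bdd_aboveI2[where M = "B\<^sup>2"] sum_le)
  have "(\<Sum>\<^sub>\<infinity>i\<in>I. (p i)\<^sup>2) \<le> B\<^sup>2"
    using summable sum_le by (intro infsum_le_finite_sums) (auto simp: square_summable_def)
  then show "square_norm I p \<le> B"
    unfolding square_norm_def using B by (simp add: real_le_lsqrt)
qed

lemma square_norm_triangle:
  assumes "square_summable I q" "square_summable I r"
    and "\<And>i. i \<in> I \<Longrightarrow> 0 \<le> p i" "\<And>i. i \<in> I \<Longrightarrow> p i \<le> q i + r i"
  shows "square_summable I p" "square_norm I p \<le> square_norm I q + square_norm I r"
proof -
  have "L2_set p F \<le> square_norm I q + square_norm I r" if F: "finite F" "F \<subseteq> I" for F
  proof -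
    have "L2_set p F \<le> L2_set (\<lambda>i. q i + r i) F"
      using F assms(3,4) by (intro L2_set_mono) auto
    also have "\<dots> \<le> L2_set q F + L2_set r F"
      by (rule L2_set_triangle_ineq)
    also have "\<dots> \<le> square_norm I q + square_norm I r"
      using F assms(1,2) by (intro add_mono L2_set_le_square_norm)
    finally show ?thesis .
  qed
  then show "square_summable I p" "square_norm I p \<le> square_norm I q + square_norm I r"
    using square_norm_le_if_finite_parts[of I p] by blast+
qed

lemma square_norm_mono:
  assumes "square_summable I q"
    and "\<And>i. i \<in> I \<Longrightarrow> 0 \<le> p i" "\<And>i. i \<in> I \<Longrightarrow> p i \<le> q i"
  shows "square_summable I p" "square_norm I p \<le> square_norm I q"
proof -
  have zero: "square_summable I (\<lambda>_. 0)" "square_norm I (\<lambda>_. 0) = 0"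
    by (simp_all add: square_summable_def square_norm_def)
  show "square_summable I p" "square_norm I p \<le> square_norm I q"
    using square_norm_triangle[OF assms(1) zero(1), of p] assms(2,3) zero(2) by simp_all
qed

text \<open>
  The Fatou lemma for square sums, in the form needed for seminorms that are only lower
  semicontinuous: on a finite part the errors \<open>\<epsilon>\<close> add up to at most
  \<open>sqrt (card F) * \<epsilon>\<close>.
\<close>

lemma square_norm_Fatou:
  fixes p :: "'i \<Rightarrow> real" and q :: "nat \<Rightarrow> 'i \<Rightarrow> real"
  assumes "\<forall>\<^sub>F k in sequentially. square_summable I (q k) \<and> square_norm I (q k) \<le> B"
    and "\<And>i. i \<in> I \<Longrightarrow> 0 \<le> p i"
    and lsc: "\<And>i \<epsilon>. i \<in> I \<Longrightarrow> 0 < \<epsilon> \<Longrightarrow> \<forall>\<^sub>F k in sequentially. p i \<le> q k i + \<epsilon>"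
  shows "square_summable I p" "square_norm I p \<le> B"
proof -
  have "L2_set p F \<le> B" if F: "finite F" "F \<subseteq> I" for F
  proof -
    have le: "L2_set p F \<le> B + \<epsilon> * sqrt (card F)" if "0 < \<epsilon>" for \<epsilon>
    proof -
      have "\<forall>\<^sub>F k in sequentially. \<forall>i\<in>F. p i \<le> q k i + \<epsilon>"
        using F lsc \<open>0 < \<epsilon>\<close> by (intro eventually_ball_finite) auto
      then have "\<forall>\<^sub>F k in sequentially. (\<forall>i\<in>F. p i \<le> q k i + \<epsilon>) \<and>
          square_summable I (q k) \<and> square_norm I (q k) \<le> B"
        using assms(1) by eventually_elim simp
      then obtain k where k: "\<forall>i\<in>F. p i \<le> q k i + \<epsilon>"
          "square_summable I (q k)" "square_norm I (q k) \<le> B"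
        using eventually_happens'[OF sequentially_bot] by blast
      have "L2_set p F \<le> L2_set (\<lambda>i. q k i + \<epsilon>) F"
        using F assms(2) k(1) by (intro L2_set_mono) auto
      also have "\<dots> \<le> L2_set (q k) F + L2_set (\<lambda>_. \<epsilon>) F"
        by (rule L2_set_triangle_ineq)
      also have "\<dots> \<le> B + \<epsilon> * sqrt (card F)"
        using L2_set_le_square_norm[OF k(2) F] k(3) \<open>0 < \<epsilon>\<close>
        by (simp add: L2_set_constant mult.commute)
      finally show ?thesis .
    qed
    show ?thesis
    proof (rule field_le_epsilon)
      fix e :: real assume e: "0 < e"
      have "L2_set p F \<le> B + e / (sqrt (card F) + 1) * sqrt (card F)"
        by (rule le) (use e in \<open>simp add: add_nonneg_pos\<close>)
      also have "\<dots> \<le> B + e"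
        using e by (simp add: divide_le_eq add_nonneg_pos distrib_left)
      finally show "L2_set p F \<le> B + e" .
    qed
  qed
  then show "square_summable I p" "square_norm I p \<le> B"
    using square_norm_le_if_finite_parts[of I p] by blast+
qed

text \<open>
  Outside a large finite set the dominating family is small, and on the finite set there is
  pointwise convergence.
\<close>

lemma square_norm_dominated_convergence:
  fixes p :: "nat \<Rightarrow> 'i \<Rightarrow> real"
  assumes G: "square_summable I G"
    and nonneg: "\<And>k i. i \<in> I \<Longrightarrow> 0 \<le> p k i"
    and le: "\<And>k i. i \<in> I \<Longrightarrow> p k i \<le> G i"
    and lim: "\<And>i. i \<in> I \<Longrightarrow> (\<lambda>k. p k i) \<longlonglongrightarrow> 0"
  shows "(\<lambda>k. square_norm I (p k)) \<longlonglongrightarrow> 0"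
proof -
  have "(\<lambda>k. \<Sum>\<^sub>\<infinity>i\<in>I. (p k i)\<^sup>2) \<longlonglongrightarrow> 0"
  proof (rule LIMSEQ_I)
    fix e :: real assume e: "0 < e"
    have sumG: "(\<lambda>i. (G i)\<^sup>2) summable_on I"
      using G by (simp add: square_summable_def)
    have sump: "(\<lambda>i. (p k i)\<^sup>2) summable_on I" for k
      using square_norm_mono(1)[OF G, of "p k"] nonneg le by (auto simp: square_summable_def)
    have "\<forall>\<^sub>F F in finite_subsets_at_top I. dist (\<Sum>i\<in>F. (G i)\<^sup>2) (\<Sum>\<^sub>\<infinity>i\<in>I. (G i)\<^sup>2) < e / 2"
      using infsum_tendsto[OF sumG] e unfolding tendsto_iff by (meson half_gt_zero)
    then obtain F where F: "finite F" "F \<subseteq> I"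
        "dist (\<Sum>i\<in>F. (G i)\<^sup>2) (\<Sum>\<^sub>\<infinity>i\<in>I. (G i)\<^sup>2) < e / 2"
      by (force simp: eventually_finite_subsets_at_top)
    have split: "infsum f I = sum f F + infsum f (I - F)" if "f summable_on I" for f :: "'i \<Rightarrow> real"
    proof -
      have "infsum f (F \<union> (I - F)) = infsum f F + infsum f (I - F)"
        using that F by (intro infsum_Un_disjoint) (auto intro: summable_on_subset_banach)
      moreover have "F \<union> (I - F) = I"
        using F(2) by blast
      ultimately show ?thesis
        using F(1) by simp
    qed
    have tailG: "(\<Sum>\<^sub>\<infinity>i\<in>I - F. (G i)\<^sup>2) < e / 2"
      using F(3) split[OF sumG] by (simp add: dist_real_def)
    have tail: "(\<Sum>\<^sub>\<infinity>i\<in>I - F. (p k i)\<^sup>2) < e / 2" for k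
    proof -
      have "(\<Sum>\<^sub>\<infinity>i\<in>I - F. (p k i)\<^sup>2) \<le> (\<Sum>\<^sub>\<infinity>i\<in>I - F. (G i)\<^sup>2)"
        using sump[of k] sumG nonneg le
        by (intro infsum_mono) (auto intro: summable_on_subset_banach power_mono)
      then show ?thesis
        using tailG by simp
    qed
    have "(\<lambda>k. \<Sum>i\<in>F. (p k i)\<^sup>2) \<longlonglongrightarrow> (\<Sum>i\<in>F. 0\<^sup>2)"
      using F(2) lim by (intro tendsto_sum tendsto_power) auto
    then have "\<forall>\<^sub>F k in sequentially. dist (\<Sum>i\<in>F. (p k i)\<^sup>2) 0 < e / 2"
      using e by (intro tendstoD) auto
    then obtain N where N: "\<And>k. k \<ge> N \<Longrightarrow> (\<Sum>i\<in>F. (p k i)\<^sup>2) < e / 2"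
      by (force simp: eventually_sequentially dist_real_def)
    have "norm ((\<Sum>\<^sub>\<infinity>i\<in>I. (p k i)\<^sup>2) - 0) < e" if "k \<ge> N" for k
    proof -
      have "0 \<le> (\<Sum>\<^sub>\<infinity>i\<in>I. (p k i)\<^sup>2)"
        by (simp add: infsum_nonneg)
      then show ?thesis
        using split[OF sump[of k]] tail[of k] N[OF that] by simp
    qed
    then show "\<exists>N. \<forall>k\<ge>N. norm ((\<Sum>\<^sub>\<infinity>i\<in>I. (p k i)\<^sup>2) - 0) < e"
      by blast
  qed
  then have "(\<lambda>k. sqrt (\<Sum>\<^sub>\<infinity>i\<in>I. (p k i)\<^sup>2)) \<longlonglongrightarrow> sqrt 0"
    by (rule tendsto_real_sqrt)
  then show ?thesis
    by (simp add: square_norm_def)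
qed

text \<open>
  The part of \<open>p k\<close> above \<open>G\<close> is bounded by \<open>d k\<close>, which is small in norm, and
  the part below \<open>G\<close> is dominated.
\<close>

lemma square_norm_perturbed_dominated_convergence:
  fixes p d :: "nat \<Rightarrow> 'i \<Rightarrow> real"
  assumes G: "square_summable I G" "\<And>i. i \<in> I \<Longrightarrow> 0 \<le> G i"
    and d: "\<And>k. square_summable I (d k)" "\<And>k i. i \<in> I \<Longrightarrow> 0 \<le> d k i"
      "(\<lambda>k. square_norm I (d k)) \<longlonglongrightarrow> 0"
    and nonneg: "\<And>k i. i \<in> I \<Longrightarrow> 0 \<le> p k i"
    and le: "\<And>k i. i \<in> I \<Longrightarrow> p k i \<le> d k i + G i"
    and lim: "\<And>i. i \<in> I \<Longrightarrow> (\<lambda>k. p k i) \<longlonglongrightarrow> 0"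
  shows "\<And>k. square_summable I (p k)" "(\<lambda>k. square_norm I (p k)) \<longlonglongrightarrow> 0"
proof -
  show "square_summable I (p k)" for k
    using square_norm_triangle(1)[of I "d k" G "p k"] G d(1) nonneg le by auto
  define q where "q k i = min (p k i) (G i)" for k i
  have q: "square_summable I (q k)" for k
    using square_norm_mono(1)[OF G(1), of "q k"] G(2) nonneg by (auto simp: q_def)
  have "(\<lambda>k. q k i) \<longlonglongrightarrow> 0" if "i \<in> I" for i
    using tendsto_min[OF lim[OF that] tendsto_const, of "G i"] G(2)[OF that]
    by (simp add: q_def min_def)
  then have "(\<lambda>k. square_norm I (q k)) \<longlonglongrightarrow> 0"
    using G nonneg by (intro square_norm_dominated_convergence[OF G(1)]) (auto simp: q_def)
  then have "(\<lambda>k. square_norm I (d k) + square_norm I (q k)) \<longlonglongrightarrow> 0"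
    using tendsto_add[OF d(3)] by fastforce
  moreover have "square_norm I (p k) \<le> square_norm I (d k) + square_norm I (q k)" for k
  proof (rule square_norm_triangle(2)[OF d(1) q])
    fix i assume i: "i \<in> I"
    show "p k i \<le> d k i + q k i"
      using le[OF i, of k] d(2)[OF i, of k] by (auto simp: q_def min_def)
  qed (use nonneg in auto)
  ultimately show "(\<lambda>k. square_norm I (p k)) \<longlonglongrightarrow> 0"
    by (intro Lim_null_comparison[of "\<lambda>k. square_norm I (p k)"
          "\<lambda>k. square_norm I (d k) + square_norm I (q k)"]) auto
qed

lemma infsum_ennreal_squares:
  "(\<Sum>\<^sub>\<infinity>i\<in>I. ennreal ((p i)\<^sup>2)) =
     (if square_summable I p then ennreal ((square_norm I p)\<^sup>2) else \<infinity>)"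
proof -
  let ?S = "\<Sum>\<^sub>\<infinity>i\<in>I. ennreal ((p i)\<^sup>2)"
  have *: "(\<Sum>i\<in>F. ennreal ((p i)\<^sup>2)) = ennreal ((L2_set p F)\<^sup>2)" for F
    by (simp add: L2_set_def sum_nonneg)
  have sup: "?S = (SUP F\<in>{F. finite F \<and> F \<subseteq> I}. ennreal ((L2_set p F)\<^sup>2))"
    unfolding * [symmetric] by (rule nonneg_infsum_complete) simp
  show ?thesis
  proof (cases "square_summable I p")
    case True
    then show ?thesis
      unfolding sup square_norm_squared
      by (subst infsum_nonneg_is_SUPREMUM_ennreal)
        (auto simp: square_summable_def L2_set_def sum_nonneg)
  next
    case False
    have "?S = \<infinity>"
    proof (rule ccontr)
      assume "?S \<noteq> \<infinity>"
      then obtain B where B: "?S = ennreal B" "0 \<le> B"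
        by (cases ?S) auto
      have "L2_set p F \<le> sqrt B" if "finite F" "F \<subseteq> I" for F
      proof -
        have "ennreal ((L2_set p F)\<^sup>2) \<le> ennreal B"
          unfolding B(1)[symmetric] sup using that by (intro SUP_upper) auto
        then show ?thesis
          using B(2) by (simp add: real_le_rsqrt)
      qed
      then show False
        using square_norm_le_if_finite_parts(1) False by blast
    qed
    then show ?thesis
      using False by simp
  qed
qed

lemma member_le_square_norm: "square_summable I p \<Longrightarrow> i \<in> I \<Longrightarrow> p i \<le> square_norm I p"
  using L2_set_le_square_norm[of I p "{i}"] by simp

lemma square_norm_Plus:
  shows "square_summable (A <+> B) p \<longleftrightarrow>
      square_summable A (\<lambda>i. p (Inl i)) \<and> square_summable B (\<lambda>i. p (Inr i))" (is ?summable)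
    and "square_summable A (\<lambda>i. p (Inl i)) \<Longrightarrow> square_summable B (\<lambda>i. p (Inr i)) \<Longrightarrow>
      (square_norm (A <+> B) p)\<^sup>2 =
        (square_norm A (\<lambda>i. p (Inl i)))\<^sup>2 + (square_norm B (\<lambda>i. p (Inr i)))\<^sup>2"
proof -
  let ?f = "\<lambda>i. (p i)\<^sup>2"
  have l: "?f summable_on Inl ` A \<longleftrightarrow> square_summable A (\<lambda>i. p (Inl i))"
    and r: "?f summable_on Inr ` B \<longleftrightarrow> square_summable B (\<lambda>i. p (Inr i))"
    by (simp_all add: summable_on_reindex square_summable_def comp_def)
  show ?summable
    unfolding l[symmetric] r[symmetric] unfolding square_summable_def Plus_def
    by (auto intro: summable_on_subset_banach summable_on_Un_disjoint)
  assume "square_summable A (\<lambda>i. p (Inl i))" "square_summable B (\<lambda>i. p (Inr i))"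
  then have "infsum ?f (A <+> B) = infsum ?f (Inl ` A) + infsum ?f (Inr ` B)"
    unfolding l[symmetric] r[symmetric] Plus_def by (intro infsum_Un_disjoint) auto
  then show "(square_norm (A <+> B) p)\<^sup>2 =
      (square_norm A (\<lambda>i. p (Inl i)))\<^sup>2 + (square_norm B (\<lambda>i. p (Inr i)))\<^sup>2"
    by (simp add: square_norm_squared infsum_reindex comp_def)
qed

lemma square_norm_cmult:
  assumes "a \<noteq> 0"
  shows "square_summable I (\<lambda>i. a * p i) \<longleftrightarrow> square_summable I p"
    and "(square_norm I (\<lambda>i. a * p i))\<^sup>2 = a\<^sup>2 * (square_norm I p)\<^sup>2"
  using assms
  by (simp_all add: square_summable_def square_norm_squared power_mult_distrib
      infsum_cmult_right' summable_on_cmult_right')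

section \<open>Positive operators on a fibre\<close>

lemma carrier_complex_ring [simp]: "carrier complex_ring = UNIV"
  by (simp add: complex_ring_def)

lemma complex_ring_ops [simp]:
  "\<zero>\<^bsub>complex_ring\<^esub> = 0" "\<one>\<^bsub>complex_ring\<^esub> = 1"
  "a \<oplus>\<^bsub>complex_ring\<^esub> b = a + b" "a \<otimes>\<^bsub>complex_ring\<^esub> b = a * b"
  by (simp_all add: complex_ring_def)

lemma cring_complex_ring: "cring complex_ring"
  by (rule cringI, rule abelian_groupI, auto simp: algebra_simps monoid_def comm_monoid_def
      comm_monoid_axioms_def intro: exI[of _ "- x" for x])

definition operator_gauge :: "'v cinner_space \<Rightarrow> ('v \<Rightarrow> 'v) \<Rightarrow> 'v \<Rightarrow> real" where
  "operator_gauge V T v = sqrt (Re (cinner V (T v) v))"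

lemma cnorm_eq_operator_gauge: "cnorm V = operator_gauge V (\<lambda>v. v)"
  by (simp add: fun_eq_iff cnorm_def operator_gauge_def)

context fd_hilbert
begin

lemma complex_minus_one: "\<ominus>\<^bsub>complex_ring\<^esub> 1 = - 1"
proof -
  have "\<ominus>\<^bsub>complex_ring\<^esub> 1 \<oplus>\<^bsub>complex_ring\<^esub> 1 = \<zero>\<^bsub>complex_ring\<^esub>"
    by (rule R.l_neg) simp
  then show ?thesis
    by (simp add: eq_neg_iff_add_eq_0)
qed

lemma smult_in_carrier [simp, intro]: "v \<in> carrier V \<Longrightarrow> a \<odot> v \<in> carrier V"
  by (rule smult_closed) simp_all

lemma minus_eq_smult: "u \<in> carrier V \<Longrightarrow> v \<in> carrier V \<Longrightarrow> u \<ominus> v = u \<oplus> (- 1) \<odot> v"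
  using smult_l_minus[of 1 v] smult_one[of v] complex_minus_one by (simp add: a_minus_def)

lemma cinner_diff_left:
  assumes "u \<in> carrier V" "v \<in> carrier V" "w \<in> carrier V"
  shows "cinner V (u \<ominus> v) w = cinner V u w - cinner V v w"
  using assms by (simp add: minus_eq_smult cinner_add_left cinner_scale_left)

lemma cinner_add_right:
  assumes "u \<in> carrier V" "v \<in> carrier V" "w \<in> carrier V"
  shows "cinner V u (v \<oplus> w) = cinner V u v + cinner V u w"
  using assms cinner_add_left[of v w u] cinner_commute[of u "v \<oplus> w"] cinner_commute[of u v]
    cinner_commute[of u w]
  by simp

lemma cinner_scale_right:
  assumes "u \<in> carrier V" "v \<in> carrier V"
  shows "cinner V u (a \<odot> v) = cnj a * cinner V u v"
  using assms cinner_scale_left[of v u a] cinner_commute[of u "a \<odot> v"] cinner_commute[of u v]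
  by simp

lemma cinner_diff_right:
  assumes "u \<in> carrier V" "v \<in> carrier V" "w \<in> carrier V"
  shows "cinner V u (v \<ominus> w) = cinner V u v - cinner V u w"
  using assms by (simp add: minus_eq_smult cinner_add_right cinner_scale_right)

end

lemma linear_between_diff:
  assumes V: "fd_hilbert V" and W: "fd_hilbert W" and T: "linear_between V W T"
    and uv: "u \<in> carrier V" "v \<in> carrier V"
  shows "T (u \<ominus>\<^bsub>V\<^esub> v) = T u \<ominus>\<^bsub>W\<^esub> T v"
proof -
  interpret V: fd_hilbert V by fact
  interpret W: fd_hilbert W by fact
  have "T u \<in> carrier W" "T v \<in> carrier W"
    using T uv by (auto simp: linear_between_def)
  then show ?thesis
    using T uv by (simp add: V.minus_eq_smult W.minus_eq_smult linear_between_def)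
qed

text \<open>
  The gauge \<open>v \<mapsto> sqrt (Re \<langle>T v, v\<rangle>)\<close> of a positive operator is a seminorm. The
  fibre norm is the case of the identity, so one development serves the norms and the potential.
\<close>

locale positive_operator = fd_hilbert V for V :: "'v cinner_space" (structure) +
  fixes T :: "'v \<Rightarrow> 'v"
  assumes linear: "linear_between V V T"
    and positive: "v \<in> carrier V \<Longrightarrow> 0 \<le> cinner V (T v) v"
begin

abbreviation real_form :: "'v \<Rightarrow> 'v \<Rightarrow> real" where
  "real_form u v \<equiv> Re (cinner V (T u) v)"

abbreviation gauge :: "'v \<Rightarrow> real" where
  "gauge \<equiv> operator_gauge V T"

lemma closed [simp, intro]: "v \<in> carrier V \<Longrightarrow> T v \<in> carrier V"
  using linear by (auto simp: linear_between_def)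

lemma T_add: "u \<in> carrier V \<Longrightarrow> v \<in> carrier V \<Longrightarrow> T (u \<oplus> v) = T u \<oplus> T v"
  and T_scale: "v \<in> carrier V \<Longrightarrow> T (a \<odot> v) = a \<odot> T v"
  using linear by (auto simp: linear_between_def)

lemma T_diff: "u \<in> carrier V \<Longrightarrow> v \<in> carrier V \<Longrightarrow> T (u \<ominus> v) = T u \<ominus> T v"
  by (rule linear_between_diff[OF _ _ linear]) unfold_locales

lemma gauge_nonneg [simp]: "v \<in> carrier V \<Longrightarrow> 0 \<le> gauge v"
  using positive[of v] by (simp add: operator_gauge_def less_eq_complex_def)

lemma gauge_squared: "v \<in> carrier V \<Longrightarrow> (gauge v)\<^sup>2 = real_form v v"
  using positive[of v] by (simp add: operator_gauge_def less_eq_complex_def)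

text \<open>
  Polarisation: \<open>\<langle>T (u + \<i> v), u + \<i> v\<rangle>\<close>, \<open>\<langle>T u, u\<rangle>\<close> and
  \<open>\<langle>T v, v\<rangle>\<close> are real.
\<close>

lemma real_form_sym:
  assumes u: "u \<in> carrier V" and v: "v \<in> carrier V"
  shows "real_form u v = real_form v u"
proof -
  have im: "Im (cinner V (T w) w) = 0" if "w \<in> carrier V" for w
    using positive[OF that] by (simp add: less_eq_complex_def)
  have "Im (cinner V (T (u \<oplus> \<i> \<odot> v)) (u \<oplus> \<i> \<odot> v)) = 0"
    by (rule im) (use u v in simp)
  then show ?thesis
    using u v im[OF u] im[OF v]
    by (simp add: T_add T_scale cinner_add_left cinner_add_right cinner_scale_left
        cinner_scale_right)
qed

lemma gauge_diff_squared:
  assumes u: "u \<in> carrier V" and v: "v \<in> carrier V"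
  shows "(gauge (u \<ominus> v))\<^sup>2 = (gauge u)\<^sup>2 + (gauge v)\<^sup>2 - 2 * real_form u v"
  using u v real_form_sym[OF u v]
  by (simp add: gauge_squared T_diff cinner_diff_left cinner_diff_right)

lemma gauge_scale:
  assumes "v \<in> carrier V" shows "gauge (complex_of_real r \<odot> v) = \<bar>r\<bar> * gauge v"
proof -
  have "(gauge (complex_of_real r \<odot> v))\<^sup>2 = (\<bar>r\<bar> * gauge v)\<^sup>2"
    using assms
    by (simp add: gauge_squared T_scale cinner_scale_left cinner_scale_right power_mult_distrib)
      (simp add: power2_eq_square)
  then show ?thesis
    using assms by (simp add: power2_eq_iff_nonneg)
qed

lemma gauge_smult_diff_squared:
  assumes u: "u \<in> carrier V" and v: "v \<in> carrier V"
  shows "(gauge (complex_of_real s \<odot> u \<ominus> complex_of_real t \<odot> v))\<^sup>2 =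
    s\<^sup>2 * (gauge u)\<^sup>2 + t\<^sup>2 * (gauge v)\<^sup>2 - 2 * s * t * real_form u v"
  using u v
  by (simp add: gauge_diff_squared gauge_scale power_mult_distrib T_scale cinner_scale_left
      cinner_scale_right)

lemma Cauchy_Schwarz:
  assumes u: "u \<in> carrier V" and v: "v \<in> carrier V"
  shows "\<bar>real_form u v\<bar> \<le> gauge u * gauge v"
proof -
  let ?B = "real_form u v"
  have quadratic: "0 \<le> s\<^sup>2 * (gauge u)\<^sup>2 + (gauge v)\<^sup>2 - 2 * s * ?B" for s
    using gauge_smult_diff_squared[OF u v, of s 1]
    by (metis mult_1 mult.right_neutral one_power2 zero_le_power2)
  show ?thesis
  proof (cases "gauge u = 0")
    case True
    have "?B = 0"
    proof (rule ccontr)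
      assume "?B \<noteq> 0"
      then have "2 * (((gauge v)\<^sup>2 + 1) / (2 * ?B)) * ?B = (gauge v)\<^sup>2 + 1"
        by simp
      then show False
        using quadratic[of "((gauge v)\<^sup>2 + 1) / (2 * ?B)"] True by simp
    qed
    then show ?thesis
      using u v by simp
  next
    case False
    have "(?B / (gauge u)\<^sup>2)\<^sup>2 * (gauge u)\<^sup>2 = ?B\<^sup>2 / (gauge u)\<^sup>2"
      "2 * (?B / (gauge u)\<^sup>2) * ?B = 2 * (?B\<^sup>2 / (gauge u)\<^sup>2)"
      using False by (simp_all add: power2_eq_square)
    then have "0 \<le> (gauge v)\<^sup>2 - ?B\<^sup>2 / (gauge u)\<^sup>2"
      using quadratic[of "?B / (gauge u)\<^sup>2"] by linarith
    then have "?B\<^sup>2 \<le> (gauge u * gauge v)\<^sup>2"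
      using False by (simp add: field_simps power_mult_distrib)
    then show ?thesis
      using u v by (metis abs_le_square_iff abs_of_nonneg gauge_nonneg mult_nonneg_nonneg)
  qed
qed

lemma gauge_diff_le:
  assumes u: "u \<in> carrier V" and v: "v \<in> carrier V"
  shows "gauge (u \<ominus> v) \<le> gauge u + gauge v"
proof (rule power2_le_imp_le)
  show "(gauge (u \<ominus> v))\<^sup>2 \<le> (gauge u + gauge v)\<^sup>2"
    using Cauchy_Schwarz[OF u v] by (simp add: gauge_diff_squared[OF u v] power2_sum)
qed (use u v in simp)

lemma gauge_reverse_triangle:
  assumes u: "u \<in> carrier V" and v: "v \<in> carrier V"
  shows "\<bar>gauge u - gauge v\<bar> \<le> gauge (u \<ominus> v)"
proof (rule power2_le_imp_le)
  show "\<bar>gauge u - gauge v\<bar>\<^sup>2 \<le> (gauge (u \<ominus> v))\<^sup>2"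
    using Cauchy_Schwarz[OF u v] by (simp add: gauge_diff_squared[OF u v] power2_diff)
qed (use u v in simp)

end

lemma (in fd_hilbert) positive_identity: "positive_operator V (\<lambda>v. v)"
  by unfold_locales (auto simp: linear_between_def cinner_nonneg)

text \<open>
  Lower semicontinuity of the gauge in the norm. By symmetry
  \<open>gauge v\<^sup>2 = \<langle>T w, v\<rangle> + \<langle>v - w, T v\<rangle>\<close> in real parts; the first term is at most
  \<open>gauge w * gauge v\<close>, and the second at most \<open>|v - w| * |T v|\<close>. As \<open>T v\<close> is fixed, this
  avoids comparing the gauge with the norm uniformly on the fibre.
\<close>

lemma (in positive_operator) gauge_lower_semicontinuous:
  assumes v: "v \<in> carrier V"
  shows "\<exists>K\<ge>0. \<forall>w\<in>carrier V. gauge v \<le> gauge w + K * cnorm V (v \<ominus> w)"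
proof (cases "gauge v = 0")
  case True
  then show ?thesis
    by (intro exI[of _ 0]) auto
next
  case False
  interpret N: positive_operator V "\<lambda>v. v"
    by (rule positive_identity)
  have pos: "0 < gauge v"
    using False v by (simp add: order_less_le)
  show ?thesis
  proof (intro exI[of _ "cnorm V (T v) / gauge v"] conjI ballI)
    show "0 \<le> cnorm V (T v) / gauge v"
      using v by (simp add: cnorm_eq_operator_gauge)
    fix w assume w: "w \<in> carrier V"
    have "gauge v * gauge v = real_form w v + real_form v (v \<ominus> w)"
      using v w gauge_squared[OF v] real_form_sym[OF v w]
      by (simp add: cinner_diff_right power2_eq_square)
    also have "\<dots> \<le> gauge w * gauge v + cnorm V (T v) * cnorm V (v \<ominus> w)"
      using Cauchy_Schwarz[OF w v] N.Cauchy_Schwarz[of "T v" "v \<ominus> w"] v w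
      by (simp add: cnorm_eq_operator_gauge)
    finally show "gauge v \<le> gauge w + cnorm V (T v) / gauge v * cnorm V (v \<ominus> w)"
      using pos by (simp add: field_simps)
  qed
qed

context fd_hilbert
begin

lemma cnorm_nonneg [simp]: "v \<in> carrier V \<Longrightarrow> 0 \<le> cnorm V v"
  and cnorm_diff_le: "u \<in> carrier V \<Longrightarrow> v \<in> carrier V \<Longrightarrow> cnorm V (u \<ominus> v) \<le> cnorm V u + cnorm V v"
  and cnorm_reverse_triangle: "u \<in> carrier V \<Longrightarrow> v \<in> carrier V \<Longrightarrow>
    \<bar>cnorm V u - cnorm V v\<bar> \<le> cnorm V (u \<ominus> v)"
  and cnorm_scale: "v \<in> carrier V \<Longrightarrow> cnorm V (complex_of_real r \<odot> v) = \<bar>r\<bar> * cnorm V v"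
  using positive_operator.gauge_nonneg[OF positive_identity]
    positive_operator.gauge_diff_le[OF positive_identity]
    positive_operator.gauge_reverse_triangle[OF positive_identity]
    positive_operator.gauge_scale[OF positive_identity]
  by (simp_all add: cnorm_eq_operator_gauge)

lemma cnorm_eq_0: "v \<in> carrier V \<Longrightarrow> cnorm V v = 0 \<Longrightarrow> v = \<zero>"
  using cinner_nonneg[of v]
  by (intro cinner_definite) (auto simp: cnorm_def less_eq_complex_def complex_eq_iff)

text \<open>
  The squared left-hand side exceeds \<open>(s * |p| - t * |q|)\<^sup>2\<close> by
  \<open>2 * s * t * (|p| * |q| - Re \<langle>p, q\<rangle>)\<close>, which is at most \<open>|p - q|\<^sup>2\<close>
  because \<open>s * t \<le> 1\<close> and \<open>2 * |p| * |q| \<le> |p|\<^sup>2 + |q|\<^sup>2\<close>.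
\<close>

lemma cnorm_smult_diff_le:
  assumes p: "p \<in> carrier V" and q: "q \<in> carrier V"
    and st: "s * t \<le> 1"
  shows "cnorm V (complex_of_real s \<odot> p \<ominus> complex_of_real t \<odot> q)
    \<le> \<bar>s * cnorm V p - t * cnorm V q\<bar> + cnorm V (p \<ominus> q)"
proof -
  interpret N: positive_operator V "\<lambda>v. v"
    by (rule positive_identity)
  let ?P = "N.gauge p" and ?Q = "N.gauge q" and ?R = "Re (cinner V p q)"
    and ?D = "N.gauge (p \<ominus> q)"
  have R: "0 \<le> ?P * ?Q - ?R"
    using N.Cauchy_Schwarz[OF p q] by simp
  have D: "?D\<^sup>2 = ?P\<^sup>2 + ?Q\<^sup>2 - 2 * ?R"
    by (rule N.gauge_diff_squared[OF p q])
  have D_nonneg: "0 \<le> ?D"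
    using p q by simp
  have "s * t * (?P * ?Q - ?R) \<le> 1 * (?P * ?Q - ?R)"
    using st R by (rule mult_right_mono)
  moreover have "2 * (?P * ?Q - ?R) \<le> ?D\<^sup>2"
    using sum_squares_bound[of ?P ?Q] D by (simp add: power2_eq_square)
  moreover have "(N.gauge (complex_of_real s \<odot> p \<ominus> complex_of_real t \<odot> q))\<^sup>2 =
      (s * ?P - t * ?Q)\<^sup>2 + 2 * (s * t * (?P * ?Q - ?R))"
    unfolding N.gauge_smult_diff_squared[OF p q] by (simp add: power2_eq_square algebra_simps)
  ultimately have "(N.gauge (complex_of_real s \<odot> p \<ominus> complex_of_real t \<odot> q))\<^sup>2
      \<le> (s * ?P - t * ?Q)\<^sup>2 + ?D\<^sup>2"
    by linarith
  also have "\<dots> \<le> (\<bar>s * ?P - t * ?Q\<bar> + ?D)\<^sup>2"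
    using D_nonneg by (simp add: power2_sum)
  finally show ?thesis
    unfolding cnorm_eq_operator_gauge by (rule power2_le_imp_le) (use D_nonneg in simp)
qed

end

section \<open>The magnetic form as a square norm\<close>

text \<open>
  The energy is the squared norm of this family of seminorms, indexed by the pairs of vertices
  and the vertices. The factor \<open>1/2\<close> of the edge sum is absorbed under the root.
\<close>

definition form_component ::
  "('x \<Rightarrow> 'x \<Rightarrow> real) \<Rightarrow> ('x \<Rightarrow> 'v cinner_space) \<Rightarrow> ('x \<Rightarrow> 'x \<Rightarrow> 'v \<Rightarrow> 'v) \<Rightarrow>
    ('x \<Rightarrow> 'v \<Rightarrow> 'v) \<Rightarrow> ('x \<Rightarrow> 'v) \<Rightarrow> 'x \<times> 'x + 'x \<Rightarrow> real" where
  "form_component b E \<Phi> W u i = (case i of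
     Inl (x, y) \<Rightarrow> sqrt (b x y / 2) * cnorm (E x) (u x \<ominus>\<^bsub>E x\<^esub> \<Phi> x y (u y))
   | Inr x \<Rightarrow> operator_gauge (E x) (W x) (u x))"

definition mass_component ::
  "('x \<Rightarrow> real) \<Rightarrow> ('x \<Rightarrow> 'v cinner_space) \<Rightarrow> ('x \<Rightarrow> 'v) \<Rightarrow> 'x \<Rightarrow> real" where
  "mass_component m E u x = sqrt (m x) * cnorm (E x) (u x)"

context fd_hilbert
begin

lemma diff_diff_distrib:
  assumes "p \<in> carrier V" "q \<in> carrier V" "r \<in> carrier V" "s \<in> carrier V"
  shows "(p \<ominus> q) \<ominus> (r \<ominus> s) = (p \<ominus> r) \<ominus> (q \<ominus> s)"
  using assms by (simp add: a_minus_def M.minus_add M.a_ac)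

lemma diff_diff_cancel_right:
  assumes "p \<in> carrier V" "q \<in> carrier V" "r \<in> carrier V"
  shows "(p \<ominus> r) \<ominus> (q \<ominus> r) = p \<ominus> q"
  using assms by (simp add: diff_diff_distrib[of p r q r]) (simp add: a_minus_def M.r_neg)

lemma diff_diff_cancel_left:
  assumes "p \<in> carrier V" "q \<in> carrier V" "r \<in> carrier V"
  shows "(p \<ominus> q) \<ominus> (p \<ominus> r) = r \<ominus> q"
  using assms by (simp add: a_minus_def M.minus_add M.a_ac M.r_neg M.r_neg1 M.r_neg2)

end

text \<open>
  The locale is stated for a general bundle because closedness is needed twice: for the given form
  and, with the trivial line bundle, for the scalar form.
\<close>

locale magnetic_bundle = weighted_graph X b m
  for X :: "'x set" and b :: "'x \<Rightarrow> 'x \<Rightarrow> real" and m :: "'x \<Rightarrow> real" +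
  fixes E :: "'x \<Rightarrow> 'v cinner_space" and \<Phi> :: "'x \<Rightarrow> 'x \<Rightarrow> 'v \<Rightarrow> 'v" and W :: "'x \<Rightarrow> 'v \<Rightarrow> 'v"
  assumes fibre: "x \<in> X \<Longrightarrow> fd_hilbert (E x)"
    and connection: "unitary_connection X E \<Phi>"
    and potential: "x \<in> X \<Longrightarrow> positive_operator (E x) (W x)"
begin

abbreviation sites :: "('x \<times> 'x + 'x) set" where
  "sites \<equiv> (X \<times> X) <+> X"

abbreviation component :: "('x \<Rightarrow> 'v) \<Rightarrow> 'x \<times> 'x + 'x \<Rightarrow> real" where
  "component \<equiv> form_component b E \<Phi> W"

abbreviation mass :: "('x \<Rightarrow> 'v) \<Rightarrow> 'x \<Rightarrow> real" where
  "mass \<equiv> mass_component m E"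

abbreviation difference :: "('x \<Rightarrow> 'v) \<Rightarrow> ('x \<Rightarrow> 'v) \<Rightarrow> 'x \<Rightarrow> 'v" where
  "difference \<equiv> section_diff X E"

abbreviation restricted_form :: "('x, 'v) qform" where
  "restricted_form \<equiv> neumann_form X b m E \<Phi> W |` fin_sections X E"

lemma section_in_fibre: "u \<in> sections X E \<Longrightarrow> x \<in> X \<Longrightarrow> u x \<in> carrier (E x)"
  by (auto simp: sections_def)

lemma difference_at: "x \<in> X \<Longrightarrow> difference u v x = u x \<ominus>\<^bsub>E x\<^esub> v x"
  by (simp add: section_diff_def)

lemma fibre_diff_closed:
  "x \<in> X \<Longrightarrow> v \<in> carrier (E x) \<Longrightarrow> w \<in> carrier (E x) \<Longrightarrow> v \<ominus>\<^bsub>E x\<^esub> w \<in> carrier (E x)"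
  using fd_hilbert.axioms(1)[OF fibre, THEN module.axioms(2)]
  by (rule abelian_group.minus_closed)

lemma difference_in_sections:
  "u \<in> sections X E \<Longrightarrow> v \<in> sections X E \<Longrightarrow> difference u v \<in> sections X E"
  by (auto simp: sections_def section_diff_def intro!: fibre_diff_closed)

lemma difference_cancel:
  assumes "u \<in> sections X E" "v \<in> sections X E" "w \<in> sections X E"
  shows "difference (difference u w) (difference v w) = difference u v"
  using assms
  by (auto simp: section_diff_def fun_eq_iff
      intro!: fd_hilbert.diff_diff_cancel_right[OF fibre] section_in_fibre)

lemma transport:
  assumes "x \<in> X" "y \<in> X"
  shows "linear_between (E y) (E x) (\<Phi> x y)"
    and "v \<in> carrier (E y) \<Longrightarrow> \<Phi> x y v \<in> carrier (E x)"
    and "v \<in> carrier (E y) \<Longrightarrow> cnorm (E x) (\<Phi> x y v) = cnorm (E y) v"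
proof -
  have unitary: "unitary_between (E y) (E x) (\<Phi> x y)"
    using connection assms by (simp add: unitary_connection_def)
  then show linear: "linear_between (E y) (E x) (\<Phi> x y)"
    by (simp add: unitary_between_def)
  show "\<Phi> x y v \<in> carrier (E x)" if "v \<in> carrier (E y)"
    using linear that by (auto simp: linear_between_def)
  show "cnorm (E x) (\<Phi> x y v) = cnorm (E y) v" if "v \<in> carrier (E y)"
    using unitary that by (simp add: unitary_between_def cnorm_def)
qed

lemma edge_difference:
  assumes u: "u \<in> sections X E" and v: "v \<in> sections X E" and xy: "x \<in> X" "y \<in> X"
  shows "difference u v x \<ominus>\<^bsub>E x\<^esub> \<Phi> x y (difference u v y) =
    (u x \<ominus>\<^bsub>E x\<^esub> \<Phi> x y (u y)) \<ominus>\<^bsub>E x\<^esub> (v x \<ominus>\<^bsub>E x\<^esub> \<Phi> x y (v y))"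
proof -
  have "\<Phi> x y (u y \<ominus>\<^bsub>E y\<^esub> v y) = \<Phi> x y (u y) \<ominus>\<^bsub>E x\<^esub> \<Phi> x y (v y)"
    using u v xy by (intro linear_between_diff fibre transport section_in_fibre)
  then show ?thesis
    using u v xy
    by (simp add: difference_at fd_hilbert.diff_diff_distrib[OF fibre] section_in_fibre transport)
qed

lemma edge_in_fibre:
  "u \<in> sections X E \<Longrightarrow> x \<in> X \<Longrightarrow> y \<in> X \<Longrightarrow> u x \<ominus>\<^bsub>E x\<^esub> \<Phi> x y (u y) \<in> carrier (E x)"
  by (intro fibre_diff_closed section_in_fibre transport)

lemma component_edge:
  "component u (Inl (x, y)) = sqrt (b x y / 2) * cnorm (E x) (u x \<ominus>\<^bsub>E x\<^esub> \<Phi> x y (u y))"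
  and component_vertex: "component u (Inr x) = operator_gauge (E x) (W x) (u x)"
  by (simp_all add: form_component_def)

lemma sites_cases [consumes 1, case_names edge vertex]:
  assumes "i \<in> sites"
  obtains x y where "i = Inl (x, y)" "x \<in> X" "y \<in> X" "0 \<le> sqrt (b x y / 2)"
  | x where "i = Inr x" "x \<in> X"
  using assms edge_nonneg by (auto elim!: PlusE)

lemma component_seminorm:
  assumes u: "u \<in> sections X E" and v: "v \<in> sections X E" and i: "i \<in> sites"
  shows "0 \<le> component u i"
    and "component (difference u v) i \<le> component u i + component v i"
    and "\<bar>component u i - component v i\<bar> \<le> component (difference u v) i"
proof -
  have "0 \<le> component u i \<and> component (difference u v) i \<le> component u i + component v i \<and>
    \<bar>component u i - component v i\<bar> \<le> component (difference u v) i"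
    using i
  proof (cases rule: sites_cases)
    case (edge x y)
    let ?u = "u x \<ominus>\<^bsub>E x\<^esub> \<Phi> x y (u y)" and ?v = "v x \<ominus>\<^bsub>E x\<^esub> \<Phi> x y (v y)"
    let ?s = "sqrt (b x y / 2)"
    interpret V: fd_hilbert "E x"
      by (rule fibre) (rule edge)
    have uv: "?u \<in> carrier (E x)" "?v \<in> carrier (E x)"
      using u v edge by (auto intro: edge_in_fibre)
    have s: "0 \<le> ?s"
      using edge edge_nonneg by simp
    have "?s * cnorm (E x) (?u \<ominus>\<^bsub>E x\<^esub> ?v) \<le> ?s * (cnorm (E x) ?u + cnorm (E x) ?v)"
      "?s * \<bar>cnorm (E x) ?u - cnorm (E x) ?v\<bar> \<le> ?s * cnorm (E x) (?u \<ominus>\<^bsub>E x\<^esub> ?v)"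
      using V.cnorm_diff_le[OF uv] V.cnorm_reverse_triangle[OF uv] s
      by (blast intro: mult_left_mono)+
    moreover have "\<bar>?s * cnorm (E x) ?u - ?s * cnorm (E x) ?v\<bar> =
        ?s * \<bar>cnorm (E x) ?u - cnorm (E x) ?v\<bar>"
      using s by (simp add: abs_mult flip: right_diff_distrib)
    moreover have "0 \<le> ?s * cnorm (E x) ?u"
      using s uv by (intro mult_nonneg_nonneg) simp_all
    ultimately show ?thesis
      unfolding edge(1) component_edge edge_difference[OF u v edge(2,3)]
      by (simp add: distrib_left)
  next
    case (vertex x)
    interpret V: positive_operator "E x" "W x"
      by (rule potential) (rule vertex)
    have "u x \<in> carrier (E x)" "v x \<in> carrier (E x)"
      using u v vertex by (auto intro: section_in_fibre)
    then show ?thesis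
      using V.gauge_diff_le[of "u x" "v x"] V.gauge_reverse_triangle[of "u x" "v x"] vertex
      by (simp add: component_vertex difference_at)
  qed
  then show "0 \<le> component u i"
    and "component (difference u v) i \<le> component u i + component v i"
    and "\<bar>component u i - component v i\<bar> \<le> component (difference u v) i"
    by simp_all
qed

lemma mass_seminorm:
  assumes u: "u \<in> sections X E" and v: "v \<in> sections X E" and x: "x \<in> X"
  shows "0 \<le> mass u x"
    and "mass (difference u v) x \<le> mass u x + mass v x"
    and "\<bar>mass u x - mass v x\<bar> \<le> mass (difference u v) x"
proof -
  interpret V: fd_hilbert "E x"
    by (rule fibre) (rule x)
  have uv: "u x \<in> carrier (E x)" "v x \<in> carrier (E x)"
    using u v x by (auto intro: section_in_fibre)
  have m: "0 < sqrt (m x)"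
    using measure_pos[OF x] by simp
  show "0 \<le> mass u x"
    using uv m by (simp add: mass_component_def)
  show "mass (difference u v) x \<le> mass u x + mass v x"
    using V.cnorm_diff_le[OF uv] m
    by (simp add: mass_component_def difference_at[OF x] flip: distrib_left)
  show "\<bar>mass u x - mass v x\<bar> \<le> mass (difference u v) x"
    using V.cnorm_reverse_triangle[OF uv] m
    by (simp add: mass_component_def difference_at[OF x] abs_mult flip: right_diff_distrib)
qed

lemma l2_sections_iff:
  "u \<in> l2_sections X m E \<longleftrightarrow> u \<in> sections X E \<and> square_summable X (mass u)"
  and l2_norm_eq: "l2_norm X m E u = square_norm X (mass u)"
proof -
  have eq: "(cnorm (E x) (u x))\<^sup>2 * m x = (mass u x)\<^sup>2" if "x \<in> X" for x
    using measure_pos[OF that] by (simp add: mass_component_def power_mult_distrib)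
  show "u \<in> l2_sections X m E \<longleftrightarrow> u \<in> sections X E \<and> square_summable X (mass u)"
    using summable_on_cong[of X, OF eq] by (simp add: l2_sections_def square_summable_def)
  show "l2_norm X m E u = square_norm X (mass u)"
    using infsum_cong[of X, OF eq] by (simp add: l2_norm_def square_norm_def)
qed

lemma magnetic_energy_eq:
  assumes u: "u \<in> sections X E"
  shows "magnetic_energy X b E \<Phi> W u = (if square_summable sites (component u)
    then ennreal ((square_norm sites (component u))\<^sup>2) else \<infinity>)"
proof -
  define p where "p = (\<lambda>(x, y). sqrt (b x y) * cnorm (E x) (u x \<ominus>\<^bsub>E x\<^esub> \<Phi> x y (u y)))"
  define q where "q = (\<lambda>x. operator_gauge (E x) (W x) (u x))"
  have Inl: "(\<lambda>e. component u (Inl e)) = (\<lambda>e. sqrt (1 / 2) * p e)"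
    by (auto simp: fun_eq_iff p_def component_edge real_sqrt_divide)
  have Inr: "(\<lambda>x. component u (Inr x)) = q"
    by (simp add: fun_eq_iff q_def component_vertex)
  have "(\<Sum>\<^sub>\<infinity>(x, y)\<in>X \<times> X. ennreal (b x y * (cnorm (E x) (u x \<ominus>\<^bsub>E x\<^esub> \<Phi> x y (u y)))\<^sup>2))
      = (\<Sum>\<^sub>\<infinity>e\<in>X \<times> X. ennreal ((p e)\<^sup>2))"
    by (rule infsum_cong) (auto simp: p_def power_mult_distrib edge_nonneg)
  moreover have "(\<Sum>\<^sub>\<infinity>x\<in>X. ennreal (Re (cinner (E x) (W x (u x)) (u x))))
      = (\<Sum>\<^sub>\<infinity>x\<in>X. ennreal ((q x)\<^sup>2))"
    using u by (intro infsum_cong)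
      (simp add: q_def positive_operator.gauge_squared[OF potential] section_in_fibre)
  ultimately have "magnetic_energy X b E \<Phi> W u =
      ennreal (1 / 2) * (\<Sum>\<^sub>\<infinity>e\<in>X \<times> X. ennreal ((p e)\<^sup>2)) + (\<Sum>\<^sub>\<infinity>x\<in>X. ennreal ((q x)\<^sup>2))"
    by (simp only: magnetic_energy_def)
  also have "\<dots> = (if square_summable (X \<times> X) p \<and> square_summable X q
      then ennreal (1 / 2 * (square_norm (X \<times> X) p)\<^sup>2 + (square_norm X q)\<^sup>2) else \<infinity>)"
    by (auto simp: infsum_ennreal_squares ennreal_mult' ennreal_plus ennreal_mult_top
        simp flip: ennreal_mult simp del: ennreal_half)
  also have "\<dots> = (if square_summable sites (component u)
      then ennreal ((square_norm sites (component u))\<^sup>2) else \<infinity>)"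
    using square_norm_Plus[where A = "X \<times> X" and B = X and p = "component u"]
      square_norm_cmult[of "sqrt (1 / 2)" "X \<times> X" p]
    unfolding Inl Inr by (auto simp: real_sqrt_divide power_divide)
  finally show ?thesis .
qed

lemma neumann_form_eq:
  "neumann_form X b m E \<Phi> W u =
    (if u \<in> sections X E \<and> square_summable X (mass u) \<and> square_summable sites (component u)
     then Some ((square_norm sites (component u))\<^sup>2) else None)"
  by (auto simp: neumann_form_def l2_sections_iff magnetic_energy_eq split: if_splits)

lemma dom_neumann_form:
  "u \<in> dom (neumann_form X b m E \<Phi> W) \<longleftrightarrow>
    u \<in> sections X E \<and> square_summable X (mass u) \<and> square_summable sites (component u)"
  by (simp add: dom_def neumann_form_eq)

lemma dom_restricted_form:
  "u \<in> dom restricted_form \<longleftrightarrow> u \<in> dom (neumann_form X b m E \<Phi> W) \<and> u \<in> fin_sections X E"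
  by (auto simp: dom_def restrict_map_def)

lemma restricted_form_value:
  assumes "u \<in> dom restricted_form"
  shows "the (restricted_form u) = (square_norm sites (component u))\<^sup>2"
proof -
  have "u \<in> dom (neumann_form X b m E \<Phi> W)" "u \<in> fin_sections X E"
    using assms by (simp_all add: dom_restricted_form)
  then show ?thesis
    unfolding dom_neumann_form by (simp add: neumann_form_eq)
qed

lemma form_norm_restricted_form:
  "u \<in> dom restricted_form \<Longrightarrow> form_norm X m E restricted_form u =
    sqrt ((square_norm sites (component u))\<^sup>2 + (square_norm X (mass u))\<^sup>2)"
  by (simp only: form_norm_def restricted_form_value l2_norm_eq)

lemma difference_in_dom_neumann:
  assumes "u \<in> dom (neumann_form X b m E \<Phi> W)" "v \<in> dom (neumann_form X b m E \<Phi> W)"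
  shows "difference u v \<in> dom (neumann_form X b m E \<Phi> W)"
proof -
  have uv: "u \<in> sections X E" "v \<in> sections X E" "difference u v \<in> sections X E"
    using assms difference_in_sections by (auto simp: dom_neumann_form)
  have "square_summable X (mass (difference u v))"
    by (rule square_norm_triangle(1)[of _ "mass u" "mass v"])
      (use assms uv mass_seminorm in \<open>auto simp: dom_neumann_form\<close>)
  moreover have "square_summable sites (component (difference u v))"
    by (rule square_norm_triangle(1)[of _ "component u" "component v"])
      (use assms uv component_seminorm in \<open>simp_all add: dom_neumann_form\<close>)
  ultimately show ?thesis
    using uv by (simp add: dom_neumann_form)
qed

lemma difference_in_dom_restricted:
  assumes "u \<in> dom restricted_form" "v \<in> dom restricted_form"
  shows "difference u v \<in> dom restricted_form"
proof -
  have uv: "u \<in> sections X E" "v \<in> sections X E"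
    using assms by (auto simp: dom_restricted_form dom_neumann_form)
  have "difference u v x = \<zero>\<^bsub>E x\<^esub>" if "x \<in> X" "u x = \<zero>\<^bsub>E x\<^esub>" "v x = \<zero>\<^bsub>E x\<^esub>" for x
  proof -
    interpret V: fd_hilbert "E x"
      by (rule fibre) (rule that)
    show ?thesis
      using that by (simp add: difference_at V.minus_eq V.M.r_neg)
  qed
  then have "{x \<in> X. difference u v x \<noteq> \<zero>\<^bsub>E x\<^esub>} \<subseteq>
      {x \<in> X. u x \<noteq> \<zero>\<^bsub>E x\<^esub>} \<union> {x \<in> X. v x \<noteq> \<zero>\<^bsub>E x\<^esub>}"
    by blast
  then have "difference u v \<in> fin_sections X E"
    using assms difference_in_sections[OF uv]
    by (auto simp: dom_restricted_form fin_sections_def intro: finite_subset)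
  then show ?thesis
    using assms difference_in_dom_neumann[of u v] by (simp add: dom_restricted_form)
qed

lemma in_dom_neumann_if_difference:
  assumes u: "u \<in> sections X E" and v: "v \<in> dom (neumann_form X b m E \<Phi> W)"
    and "square_summable X (mass (difference u v))"
    and "square_summable sites (component (difference u v))"
  shows "u \<in> dom (neumann_form X b m E \<Phi> W)"
proof -
  have vs: "v \<in> sections X E"
    using v by (simp add: dom_neumann_form)
  have "square_summable X (mass u)"
  proof (rule square_norm_triangle(1))
    show "mass u x \<le> mass (difference u v) x + mass v x" if "x \<in> X" for x
      using mass_seminorm(3)[OF u vs that] by simp
  qed (use assms mass_seminorm(1)[OF u vs] in \<open>auto simp: dom_neumann_form\<close>)
  moreover have "square_summable sites (component u)"
  proof (rule square_norm_triangle(1))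
    show "component u i \<le> component (difference u v) i + component v i" if "i \<in> sites" for i
      using component_seminorm(3)[OF u vs that] by simp
  qed (use assms component_seminorm(1)[OF u vs] in \<open>auto simp: dom_neumann_form\<close>)
  ultimately show ?thesis
    using u by (simp add: dom_neumann_form)
qed

section \<open>Closedness\<close>

lemma pointwise_convergence:
  assumes "\<And>k. square_summable X (mass (difference (f k) u))"
    and "(\<lambda>k. l2_norm X m E (difference (f k) u)) \<longlonglongrightarrow> 0" and x: "x \<in> X"
    and f: "\<And>k. f k \<in> sections X E" and u: "u \<in> sections X E"
  shows "(\<lambda>k. cnorm (E x) (f k x \<ominus>\<^bsub>E x\<^esub> u x)) \<longlonglongrightarrow> 0"
proof -
  let ?c = "\<lambda>k. cnorm (E x) (f k x \<ominus>\<^bsub>E x\<^esub> u x)"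
  have m: "0 < sqrt (m x)"
    using measure_pos[OF x] by simp
  have "(\<lambda>k. l2_norm X m E (difference (f k) u) / sqrt (m x)) \<longlonglongrightarrow> 0"
    using tendsto_divide[OF assms(2) tendsto_const, of "sqrt (m x)"] m by simp
  moreover have "?c k \<le> l2_norm X m E (difference (f k) u) / sqrt (m x)" for k
    using member_le_square_norm[OF assms(1)[of k] x] m
    by (simp add: l2_norm_eq mass_component_def difference_at[OF x] field_simps)
  moreover have "0 \<le> ?c k" for k
    by (intro fd_hilbert.cnorm_nonneg fibre fibre_diff_closed section_in_fibre x f u)
  ultimately show ?thesis
    by (intro Lim_null_comparison[of ?c]) auto
qed

text \<open>
  The edge seminorms are continuous for pointwise convergence; for the vertex seminorms
  \<open>gauge_lower_semicontinuous\<close> applies.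
\<close>

lemma component_lower_semicontinuous:
  assumes g: "g \<in> sections X E" and u: "u \<in> sections X E" and f: "\<And>k. f k \<in> sections X E"
    and conv: "\<And>x. x \<in> X \<Longrightarrow> (\<lambda>k. cnorm (E x) (f k x \<ominus>\<^bsub>E x\<^esub> u x)) \<longlonglongrightarrow> 0"
    and i: "i \<in> sites" and e: "0 < e"
  shows "\<forall>\<^sub>F k in sequentially. component (difference g u) i \<le> component (difference g (f k)) i + e"
proof -
  have "\<exists>r. r \<longlonglongrightarrow> 0 \<and>
      (\<forall>k. component (difference g u) i \<le> component (difference g (f k)) i + r k)"
    using i
  proof (cases rule: sites_cases)
    case (edge x y)
    let ?s = "sqrt (b x y / 2)"
    let ?r = "\<lambda>k. ?s * (cnorm (E x) (f k x \<ominus>\<^bsub>E x\<^esub> u x) + cnorm (E y) (f k y \<ominus>\<^bsub>E y\<^esub> u y))"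
    have "component (difference g u) i \<le> component (difference g (f k)) i + ?r k" for k
    proof -
      interpret V: fd_hilbert "E x"
        by (rule fibre) (rule edge)
      note gfu = g f[of k] u
      have "difference (difference g u) (difference g (f k)) x = f k x \<ominus>\<^bsub>E x\<^esub> u x" if "x \<in> X" for x
        using gfu that
        by (simp add: difference_at fd_hilbert.diff_diff_cancel_left[OF fibre] section_in_fibre)
      then have "component (difference (difference g u) (difference g (f k))) i =
          ?s * cnorm (E x) ((f k x \<ominus>\<^bsub>E x\<^esub> u x) \<ominus>\<^bsub>E x\<^esub> \<Phi> x y (f k y \<ominus>\<^bsub>E y\<^esub> u y))"
        using edge by (simp add: component_edge)
      also have "\<dots> \<le> ?s * (cnorm (E x) (f k x \<ominus>\<^bsub>E x\<^esub> u x) +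
          cnorm (E x) (\<Phi> x y (f k y \<ominus>\<^bsub>E y\<^esub> u y)))"
        using edge gfu
        by (intro mult_left_mono V.cnorm_diff_le fibre_diff_closed transport section_in_fibre) auto
      also have "\<dots> = ?r k"
        using edge gfu by (simp add: transport fibre_diff_closed section_in_fibre)
      finally show ?thesis
        using component_seminorm(3)[OF difference_in_sections[OF g u]
            difference_in_sections[OF g f[of k]] i]
        by simp
    qed
    moreover have "?r \<longlonglongrightarrow> ?s * (0 + 0)"
      using edge by (intro tendsto_intros conv)
    ultimately show ?thesis
      by (intro exI[of _ ?r]) simp
  next
    case (vertex x)
    interpret V: positive_operator "E x" "W x"
      by (rule potential) (rule vertex)
    have gx: "g x \<ominus>\<^bsub>E x\<^esub> u x \<in> carrier (E x)" "g x \<ominus>\<^bsub>E x\<^esub> f k x \<in> carrier (E x)" for k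
      using g u f vertex by (simp_all add: fibre_diff_closed section_in_fibre)
    have cancel: "(g x \<ominus>\<^bsub>E x\<^esub> u x) \<ominus>\<^bsub>E x\<^esub> (g x \<ominus>\<^bsub>E x\<^esub> f k x) = f k x \<ominus>\<^bsub>E x\<^esub> u x" for k
      using g u f vertex by (intro V.diff_diff_cancel_left section_in_fibre)
    obtain K where K: "\<And>w. w \<in> carrier (E x) \<Longrightarrow>
        V.gauge (g x \<ominus>\<^bsub>E x\<^esub> u x) \<le> V.gauge w + K * cnorm (E x) ((g x \<ominus>\<^bsub>E x\<^esub> u x) \<ominus>\<^bsub>E x\<^esub> w)"
      using V.gauge_lower_semicontinuous[OF gx(1)] by blast
    have "(\<lambda>k. K * cnorm (E x) (f k x \<ominus>\<^bsub>E x\<^esub> u x)) \<longlonglongrightarrow> K * 0"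
      using vertex by (intro tendsto_intros conv)
    moreover have "component (difference g u) i \<le>
        component (difference g (f k)) i + K * cnorm (E x) (f k x \<ominus>\<^bsub>E x\<^esub> u x)" for k
      using K[OF gx(2)[of k]] vertex unfolding cancel
      by (simp add: component_vertex difference_at)
    ultimately show ?thesis
      by (intro exI[of _ "\<lambda>k. K * cnorm (E x) (f k x \<ominus>\<^bsub>E x\<^esub> u x)"]) simp
  qed
  then obtain r where r: "r \<longlonglongrightarrow> 0"
    "\<And>k. component (difference g u) i \<le> component (difference g (f k)) i + r k"
    by blast
  have "\<forall>\<^sub>F k in sequentially. r k < e"
    using order_tendstoD(2)[OF r(1) e] .
  then show ?thesis
  proof eventually_elim
    case (elim k)
    then show ?case
      using r(2)[of k] by simp
  qed
qed

text \<open>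
  For a form-Cauchy sequence the energy of \<open>f k - f j\<close> is small for large \<open>k, j\<close>; the
  Fatou lemma in \<open>j\<close> bounds the energy of \<open>f k - u\<close>.
\<close>

lemma form_limit:
  assumes approx: "form_approximates X m E restricted_form f u" and u: "u \<in> l2_sections X m E"
  shows "u \<in> dom (neumann_form X b m E \<Phi> W)"
    and "(\<lambda>k. square_norm sites (component (difference (f k) u))) \<longlonglongrightarrow> 0"
proof -
  have us: "u \<in> sections X E" "square_summable X (mass u)"
    using u by (auto simp: l2_sections_iff)
  have fdom: "f k \<in> dom restricted_form" for k
    using approx by (simp add: form_approximates_def)
  then have fN: "f k \<in> dom (neumann_form X b m E \<Phi> W)" for k
    by (simp add: dom_restricted_form)
  then have fs: "f k \<in> sections X E" "square_summable X (mass (f k))" for k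
    by (simp_all add: dom_neumann_form)
  have diff_mass: "square_summable X (mass (difference (f k) u))" for k
    by (rule square_norm_triangle(1)[of _ "mass (f k)" "mass u"])
      (use fs us mass_seminorm difference_in_sections in auto)
  have conv: "(\<lambda>k. cnorm (E x) (f k x \<ominus>\<^bsub>E x\<^esub> u x)) \<longlonglongrightarrow> 0" if "x \<in> X" for x
    using approx by (intro pointwise_convergence diff_mass fs us that)
      (simp add: form_approximates_def)
  have bound: "\<exists>N. \<forall>k\<ge>N. square_summable sites (component (difference (f k) u)) \<and>
      square_norm sites (component (difference (f k) u)) \<le> e" if e: "0 < e" for e
  proof -
    obtain N where N: "\<And>k j. k \<ge> N \<Longrightarrow> j \<ge> N \<Longrightarrow>
        form_norm X m E restricted_form (difference (f k) (f j)) < e"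
      using approx e unfolding form_approximates_def by blast
    have cauchy: "square_summable sites (component (difference (f k) (f j))) \<and>
        square_norm sites (component (difference (f k) (f j))) \<le> e" if "k \<ge> N" "j \<ge> N" for k j
    proof -
      have dom: "difference (f k) (f j) \<in> dom restricted_form"
        by (intro difference_in_dom_restricted fdom)
      have "square_norm sites (component (difference (f k) (f j))) \<le>
          form_norm X m E restricted_form (difference (f k) (f j))"
        unfolding form_norm_restricted_form[OF dom] by (rule real_le_rsqrt) simp
      then show ?thesis
        using N[OF that] dom by (simp add: dom_restricted_form dom_neumann_form)
    qed
    have "square_summable sites (component (difference (f k) u)) \<and>
        square_norm sites (component (difference (f k) u)) \<le> e" if k: "k \<ge> N" for k
    proof -
      have ev: "\<forall>\<^sub>F j in sequentially. square_summable sites (component (difference (f k) (f j))) \<and>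
          square_norm sites (component (difference (f k) (f j))) \<le> e"
        using cauchy[OF k] unfolding eventually_sequentially by blast
      have nonneg: "0 \<le> component (difference (f k) u) i" if "i \<in> sites" for i
        using component_seminorm(1)[OF difference_in_sections[OF fs(1)[of k] us(1)] us(1) that] .
      have lsc: "\<forall>\<^sub>F j in sequentially.
          component (difference (f k) u) i \<le> component (difference (f k) (f j)) i + \<epsilon>"
        if "i \<in> sites" "0 < \<epsilon>" for i \<epsilon>
        using fs us conv that by (intro component_lower_semicontinuous)
      show ?thesis
        using square_norm_Fatou[OF ev nonneg lsc] by blast
    qed
    then show ?thesis
      by blast
  qed
  obtain N where N: "square_summable sites (component (difference (f N) u))"
    using bound[of 1] by auto
  have "square_summable sites (component u)"
  proof (rule square_norm_triangle(1)[OF N])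
    show "square_summable sites (component (f N))"
      using fN by (simp add: dom_neumann_form)
    show "component u i \<le> component (difference (f N) u) i + component (f N) i"
      if "i \<in> sites" for i
      using component_seminorm(3)[OF fs(1)[of N] us(1) that] by simp
  qed (rule component_seminorm(1)[OF us(1) us(1)])
  then show "u \<in> dom (neumann_form X b m E \<Phi> W)"
    using us by (simp add: dom_neumann_form)
  show "(\<lambda>k. square_norm sites (component (difference (f k) u))) \<longlonglongrightarrow> 0"
  proof (rule LIMSEQ_I)
    fix e :: real assume "0 < e"
    then obtain N where "\<forall>k\<ge>N. square_norm sites (component (difference (f k) u)) \<le> e / 2"
      using bound[of "e / 2"] by auto
    then have "norm (square_norm sites (component (difference (f k) u)) - 0) < e" if "k \<ge> N" for k
      using that \<open>0 < e\<close> by force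
    then show "\<exists>N. \<forall>k\<ge>N. norm (square_norm sites (component (difference (f k) u)) - 0) < e"
      by blast
  qed
qed

lemma form_approximates_iff:
  assumes u: "u \<in> dom (neumann_form X b m E \<Phi> W)"
  shows "form_approximates X m E restricted_form f u \<longleftrightarrow>
    (\<forall>k. f k \<in> dom restricted_form) \<and>
    (\<lambda>k. square_norm sites (component (difference (f k) u))) \<longlonglongrightarrow> 0 \<and>
    (\<lambda>k. square_norm X (mass (difference (f k) u))) \<longlonglongrightarrow> 0" (is "?L \<longleftrightarrow> ?R")
proof
  assume ?L
  moreover have "u \<in> l2_sections X m E"
    using u by (simp add: dom_neumann_form l2_sections_iff)
  ultimately show ?R
    using form_limit(2) by (simp add: form_approximates_def l2_norm_eq)
next
  assume R: ?R
  let ?q = "\<lambda>k. square_norm sites (component (difference (f k) u))"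
  let ?n = "\<lambda>k. square_norm X (mass (difference (f k) u))"
  have us: "u \<in> sections X E"
    using u by (simp add: dom_neumann_form)
  have fN: "f k \<in> dom (neumann_form X b m E \<Phi> W)" for k
    using R by (simp add: dom_restricted_form)
  then have fs: "f k \<in> sections X E" for k
    by (simp add: dom_neumann_form)
  have fu: "difference (f k) u \<in> dom (neumann_form X b m E \<Phi> W)" for k
    by (intro difference_in_dom_neumann fN u)
  then have fus: "difference (f k) u \<in> sections X E" for k
    by (simp add: dom_neumann_form)
  have norm_le: "form_norm X m E restricted_form (difference (f k) (f j)) \<le>
      (?q k + ?q j) + (?n k + ?n j)" for k j
  proof -
    have dom: "difference (f k) (f j) \<in> dom restricted_form"
      using R by (intro difference_in_dom_restricted) auto
    have s: "difference (f k) (f j) \<in> sections X E"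
      by (intro difference_in_sections fs)
    have cancel: "difference (difference (f k) u) (difference (f j) u) = difference (f k) (f j)"
      by (intro difference_cancel fs us)
    have "square_norm sites (component (difference (f k) (f j))) \<le> ?q k + ?q j"
      using fu component_seminorm(1)[OF s us] component_seminorm(2)[OF fus[of k] fus[of j]]
      unfolding cancel dom_neumann_form by (intro square_norm_triangle(2)) blast+
    moreover have "square_norm X (mass (difference (f k) (f j))) \<le> ?n k + ?n j"
      using fu mass_seminorm(1)[OF s us] mass_seminorm(2)[OF fus[of k] fus[of j]]
      unfolding cancel dom_neumann_form by (intro square_norm_triangle(2)) blast+
    moreover have "form_norm X m E restricted_form (difference (f k) (f j)) \<le>
        square_norm sites (component (difference (f k) (f j))) +
        square_norm X (mass (difference (f k) (f j)))"
      unfolding form_norm_restricted_form[OF dom] by (rule sqrt_sum_squares_le_sum) simp_all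
    ultimately show ?thesis
      by linarith
  qed
  have "\<exists>N. \<forall>k\<ge>N. \<forall>j\<ge>N. form_norm X m E restricted_form (difference (f k) (f j)) < e"
    if e: "0 < e" for e
  proof -
    have "(\<lambda>k. ?q k + ?n k) \<longlonglongrightarrow> 0 + 0"
      using R by (intro tendsto_add) auto
    then have "\<forall>\<^sub>F k in sequentially. ?q k + ?n k < e / 2"
      using e by (intro order_tendstoD) auto
    then obtain N where N: "\<And>k. k \<ge> N \<Longrightarrow> ?q k + ?n k < e / 2"
      unfolding eventually_sequentially by blast
    have "form_norm X m E restricted_form (difference (f k) (f j)) < e" if "k \<ge> N" "j \<ge> N" for k j
      using norm_le[of k j] N[OF that(1)] N[OF that(2)] by linarith
    then show ?thesis
      by blast
  qed
  then show ?L
    using R by (simp add: form_approximates_def l2_norm_eq)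
qed

text \<open>
  Since the Neumann form is closed, the values of the closure are the Neumann values, and the two
  forms can differ only in their domains.
\<close>

lemma dirichlet_eq_neumann_iff:
  "dirichlet_form X b m E \<Phi> W = neumann_form X b m E \<Phi> W \<longleftrightarrow>
    (\<forall>u\<in>dom (neumann_form X b m E \<Phi> W). \<exists>f. form_approximates X m E restricted_form f u)"
proof -
  let ?N = "neumann_form X b m E \<Phi> W"
  let ?approximable = "\<lambda>u. \<exists>f. form_approximates X m E restricted_form f u"
  have closure_value: "(THE r. \<forall>f. form_approximates X m E restricted_form f u \<longrightarrow>
      (\<lambda>n. the (restricted_form (f n))) \<longlonglongrightarrow> r) = the (?N u)"
    if u: "u \<in> dom ?N" and approximable: "?approximable u" for u
  proof -
    have us: "u \<in> sections X E" "square_summable sites (component u)"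
      using u by (simp_all add: dom_neumann_form)
    have lim: "(\<lambda>n. the (restricted_form (f n))) \<longlonglongrightarrow> the (?N u)"
      if f: "form_approximates X m E restricted_form f u" for f
    proof -
      have fdom: "f n \<in> dom restricted_form" for n
        using f by (simp add: form_approximates_def)
      then have fN: "f n \<in> dom ?N" for n
        by (simp add: dom_restricted_form)
      then have fs: "f n \<in> sections X E" "square_summable sites (component (f n))" for n
        by (simp_all add: dom_neumann_form)
      let ?d = "\<lambda>n. square_norm sites (component (difference (f n) u))"
      have d: "?d \<longlonglongrightarrow> 0"
        using f u by (simp add: form_approximates_iff)
      have summable: "square_summable sites (component (difference (f n) u))" for n
        using difference_in_dom_neumann[OF fN u] by (simp add: dom_neumann_form)
      have le: "square_norm sites (component (f n)) \<le> ?d n + square_norm sites (component u)" for n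
        using component_seminorm(1,3)[OF fs(1)[of n] us(1)]
        by (intro square_norm_triangle(2) summable us) (auto simp: abs_le_iff algebra_simps)
      have ge: "square_norm sites (component u) \<le> ?d n + square_norm sites (component (f n))" for n
        using component_seminorm(1)[OF us(1) us(1)] component_seminorm(3)[OF fs(1)[of n] us(1)]
        by (intro square_norm_triangle(2) summable fs) (auto simp: abs_le_iff algebra_simps)
      have "(\<lambda>n. square_norm sites (component (f n)) - square_norm sites (component u)) \<longlonglongrightarrow> 0"
      proof (rule Lim_null_comparison[OF _ d], intro always_eventually allI)
        show "norm (square_norm sites (component (f n)) - square_norm sites (component u)) \<le> ?d n" for n
          using le[of n] ge[of n] by simp
      qed
      then have "(\<lambda>n. square_norm sites (component (f n))) \<longlonglongrightarrow> square_norm sites (component u)"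
        by (rule LIM_zero_cancel)
      then have "(\<lambda>n. (square_norm sites (component (f n)))\<^sup>2) \<longlonglongrightarrow> (square_norm sites (component u))\<^sup>2"
        by (intro tendsto_intros)
      then show ?thesis
        using u fdom by (simp add: restricted_form_value neumann_form_eq dom_neumann_form)
    qed
    show ?thesis
      using lim approximable by (intro the_equality) (blast intro: LIMSEQ_unique)+
  qed
  have l2: "u \<in> l2_sections X m E" if "u \<in> dom ?N" for u
    using that by (simp add: dom_neumann_form l2_sections_iff)
  have dirichlet: "dirichlet_form X b m E \<Phi> W u = (if u \<in> dom ?N \<and> ?approximable u then ?N u else None)" for u
    using closure_value[of u] l2[of u] form_limit(1)[of _ u]
    by (auto simp: dirichlet_form_def form_closure_def)
  show ?thesis
    unfolding fun_eq_iff dirichlet by (metis (no_types, lifting) domIff)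
qed

end

section \<open>Comparison with the scalar form\<close>

lemma complex_line_simps [simp]:
  "carrier complex_line = UNIV" "\<zero>\<^bsub>complex_line\<^esub> = 0"
  "z \<oplus>\<^bsub>complex_line\<^esub> w = z + w" "z \<odot>\<^bsub>complex_line\<^esub> w = z * w"
  "cinner complex_line z w = z * cnj w"
  by (simp_all add: complex_line_def)

lemma fd_hilbert_complex_line: "fd_hilbert complex_line"
proof -
  have group: "abelian_group complex_line"
    by (rule abelian_groupI) (auto simp: algebra_simps intro: exI[of _ "- x" for x])
  have module: "Module.module complex_ring complex_line"
    by (rule Module.moduleI[OF cring_complex_ring group]) (simp_all add: algebra_simps)
  interpret M: Module.module complex_ring complex_line
    by (rule module)
  have "\<exists>a. v = finsum complex_line (\<lambda>e. a e \<odot>\<^bsub>complex_line\<^esub> e) {1}" for v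
    by (intro exI[of _ "\<lambda>_. v"]) simp
  then have "\<exists>B. finite B \<and> B \<subseteq> carrier complex_line \<and>
      (\<forall>v\<in>carrier complex_line. \<exists>a. v = finsum complex_line (\<lambda>e. a e \<odot>\<^bsub>complex_line\<^esub> e) B)"
    by (intro exI[of _ "{1}"]) simp
  moreover have "0 \<le> z * cnj z" for z :: complex
    by (simp add: complex_mult_cnj less_eq_complex_def)
  ultimately show ?thesis
    using module by (intro fd_hilbert.intro fd_hilbert_axioms.intro) (simp_all add: distrib_right)
qed

lemma complex_line_diff [simp]: "z \<ominus>\<^bsub>complex_line\<^esub> w = z - w"
proof -
  interpret fd_hilbert complex_line
    by (rule fd_hilbert_complex_line)
  show ?thesis
    using minus_eq_smult[of z w] by simp
qed

lemma cnorm_complex_line [simp]: "cnorm complex_line = cmod"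
  by (simp add: fun_eq_iff cnorm_def complex_norm_square[symmetric] complex_mult_cnj cmod_def)

lemma (in weighted_graph) scalar_bundle:
  assumes "\<forall>x\<in>X. 0 \<le> c x"
  shows "magnetic_bundle X b m (\<lambda>_. complex_line) (\<lambda>_ _ z. z) (\<lambda>x z. complex_of_real (c x) * z)"
proof (intro magnetic_bundle.intro magnetic_bundle_axioms.intro)
  show "weighted_graph X b m"
    by (rule weighted_graph_axioms)
  show "unitary_connection X (\<lambda>_. complex_line) (\<lambda>_ _ z. z)"
    by (simp add: unitary_connection_def unitary_between_def linear_between_def
        bij_betw_def)
  show "positive_operator complex_line (\<lambda>z. complex_of_real (c x) * z)" if "x \<in> X" for x
  proof -
    have eq: "complex_of_real (c x) * z * cnj z = complex_of_real (c x * (cmod z)\<^sup>2)" for z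
      using complex_norm_square[of z] by (simp add: mult.assoc)
    have "0 \<le> complex_of_real (c x) * z * cnj z" for z
      unfolding eq less_eq_complex_def Re_complex_of_real Im_complex_of_real
      using assms that by simp
    then show ?thesis
      by (intro positive_operator.intro fd_hilbert_complex_line positive_operator_axioms.intro)
        (simp_all add: linear_between_def distrib_left)
  qed
qed (rule fd_hilbert_complex_line)

context magnetic_bundle
begin

text \<open>
  Kato's inequality, term by term. On an edge it is the reverse triangle inequality, because
  \<open>\<Phi> x y\<close> preserves norms; on a vertex it is the lower bound \<open>c\<close> for \<open>W\<close>.
\<close>

lemma modulus_component_le:
  assumes c: "\<forall>x\<in>X. 0 \<le> c x" and W: "bounded_below_by X E W c"
    and u: "u \<in> sections X E" and i: "i \<in> sites"
  shows "form_component b (\<lambda>_. complex_line) (\<lambda>_ _ z. z) (\<lambda>x z. complex_of_real (c x) * z)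
      (\<lambda>x\<in>X. complex_of_real (cnorm (E x) (u x))) i \<le> component u i"
  using i
proof (cases rule: sites_cases)
  case (edge x y)
  have "\<bar>cnorm (E x) (u x) - cnorm (E x) (\<Phi> x y (u y))\<bar> \<le> cnorm (E x) (u x \<ominus>\<^bsub>E x\<^esub> \<Phi> x y (u y))"
    using u edge by (intro fd_hilbert.cnorm_reverse_triangle fibre transport section_in_fibre)
  then show ?thesis
    using edge u edge_nonneg[of x y]
    by (simp add: form_component_def transport section_in_fibre mult_left_mono
        flip: of_real_diff)
next
  case (vertex x)
  interpret V: positive_operator "E x" "W x"
    by (rule potential) (rule vertex)
  have ux: "u x \<in> carrier (E x)"
    using u vertex by (intro section_in_fibre)
  have "c x * (cnorm (E x) (u x))\<^sup>2 \<le> Re (cinner (E x) (W x (u x)) (u x))"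
    using W ux vertex V.cinner_nonneg[OF ux]
    by (auto simp: bounded_below_by_def V.cinner_scale_left less_eq_complex_def cnorm_def)
  then show ?thesis
    using vertex by (simp add: form_component_def operator_gauge_def power2_eq_square mult.assoc)
qed

text \<open>
  Let \<open>\<phi> k\<close> be finitely supported functions approximating \<open>|u|\<close> in the scalar form norm. The
  approximating sections are \<open>(1 - s k) u\<close>, where \<open>s k * |u|\<close> is \<open>|u| - Re (\<phi> k)\<close> truncated
  below at \<open>0\<close> and above at \<open>|u|\<close>; they vanish where \<open>\<phi> k\<close> does. Each component of the error
  \<open>- s k * u\<close> is at most the component of \<open>\<phi> k - |u|\<close>, which is small in norm, plus twice the
  component of \<open>u\<close>, which does not depend on \<open>k\<close>. So the perturbed form of dominated convergence
  gives convergence in the form norm itself, without passing to weak limits and convex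
  combinations.
\<close>

lemma approximable_if_scalar_forms_agree:
  assumes c: "\<forall>x\<in>X. 0 \<le> c x" and W: "bounded_below_by X E W c"
    and scalar: "scalar_dirichlet_form X b m c = scalar_neumann_form X b m c"
    and u: "u \<in> dom (neumann_form X b m E \<Phi> W)"
  shows "\<exists>f. form_approximates X m E restricted_form f u"
proof -
  interpret S: magnetic_bundle X b m "\<lambda>_. complex_line" "\<lambda>_ _ z. z"
      "\<lambda>x z. complex_of_real (c x) * z"
    by (rule scalar_bundle) (rule c)
  define A where "A x = cnorm (E x) (u x)" for x
  define U where "U = (\<lambda>x\<in>X. complex_of_real (A x))"
  have us: "u \<in> sections X E" "square_summable X (mass u)" "square_summable sites (component u)"
    using u by (simp_all add: dom_neumann_form)
  have ux: "u x \<in> carrier (E x)" if "x \<in> X" for x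
    using us(1) that by (rule section_in_fibre)
  have A_nonneg: "0 \<le> A x" if "x \<in> X" for x
    unfolding A_def by (rule fd_hilbert.cnorm_nonneg[OF fibre ux]) (rule that)+
  have Us: "U \<in> sections X (\<lambda>_. complex_line)"
    by (simp add: U_def sections_def)
  have Kato: "S.component U i \<le> component u i" if "i \<in> sites" for i
    unfolding U_def A_def by (rule modulus_component_le[OF c W us(1) that])
  have U: "U \<in> dom (neumann_form X b m (\<lambda>_. complex_line) (\<lambda>_ _ z. z)
      (\<lambda>x z. complex_of_real (c x) * z))"
    unfolding S.dom_neumann_form
  proof (intro conjI Us)
    show "square_summable X (S.mass U)"
      by (rule square_norm_mono(1)[OF us(2)])
        (use S.mass_seminorm(1)[OF Us Us] A_nonneg in
          \<open>auto simp: mass_component_def U_def A_def\<close>)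
    show "square_summable sites (S.component U)"
      using us(3) S.component_seminorm(1)[OF Us Us] Kato by (rule square_norm_mono(1))
  qed
  obtain \<phi> where \<phi>: "form_approximates X m (\<lambda>_. complex_line) S.restricted_form \<phi> U"
    using scalar U S.dirichlet_eq_neumann_iff
    unfolding scalar_dirichlet_form_def scalar_neumann_form_def by blast
  have \<phi>_dom: "\<phi> k \<in> dom S.restricted_form" for k
    using \<phi> by (simp add: form_approximates_def)
  then have \<phi>N: "\<phi> k \<in> dom (neumann_form X b m (\<lambda>_. complex_line) (\<lambda>_ _ z. z)
      (\<lambda>x z. complex_of_real (c x) * z))" for k
    by (simp only: S.dom_restricted_form)
  have \<phi>s: "\<phi> k \<in> sections X (\<lambda>_. complex_line)" for k
    using \<phi>N[of k] by (simp only: S.dom_neumann_form)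
  define d where "d k = S.difference (\<phi> k) U" for k
  have d_dom: "d k \<in> dom (neumann_form X b m (\<lambda>_. complex_line) (\<lambda>_ _ z. z)
      (\<lambda>x z. complex_of_real (c x) * z))" for k
    unfolding d_def by (intro S.difference_in_dom_neumann \<phi>N U)
  then have d: "d k \<in> sections X (\<lambda>_. complex_line)" "square_summable X (S.mass (d k))"
      "square_summable sites (S.component (d k))" for k
    by (simp_all only: S.dom_neumann_form)
  have d_lim: "(\<lambda>k. square_norm sites (S.component (d k))) \<longlonglongrightarrow> 0"
      "(\<lambda>k. square_norm X (S.mass (d k))) \<longlonglongrightarrow> 0"
    using \<phi> unfolding S.form_approximates_iff[OF U] d_def by simp_all
  have d_at: "d k x = \<phi> k x - complex_of_real (A x)" if "x \<in> X" for k x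
    using that by (simp add: d_def S.difference_at U_def)
  have d_pointwise: "(\<lambda>k. cmod (d k x)) \<longlonglongrightarrow> 0" if "x \<in> X" for x
  proof -
    have "(\<lambda>k. cnorm complex_line (\<phi> k x \<ominus>\<^bsub>complex_line\<^esub> U x)) \<longlonglongrightarrow> 0"
      using d(2) d_lim(2) unfolding d_def
      by (intro S.pointwise_convergence \<phi>s Us that) (simp_all only: S.l2_norm_eq)
    then show ?thesis
      using that by (simp add: d_at U_def)
  qed
  \<comment> \<open>The truncation and the relative cutoff; where \<open>u\<close> vanishes, division by zero gives \<open>s = 0\<close>.\<close>
  define a where "a k x = max 0 (min (A x) (A x - Re (\<phi> k x)))" for k x
  define s where "s k x = a k x / A x" for k x
  have a_le: "0 \<le> a k x" "a k x \<le> A x" "a k x \<le> cmod (d k x)" if "x \<in> X" for k x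
    using A_nonneg[OF that] abs_Re_le_cmod[of "d k x"] by (auto simp: a_def d_at[OF that])
  have s_A: "s k x * A x = a k x" if "x \<in> X" for k x
    using a_le(1,2)[OF that, of k] by (auto simp: s_def)
  have s_bounds: "0 \<le> s k x" "s k x \<le> 1" if "x \<in> X" for k x
    using a_le(1,2)[OF that, of k] A_nonneg[OF that] by (auto simp: s_def divide_le_eq_1)
  have a_pointwise: "(\<lambda>k. a k x) \<longlonglongrightarrow> 0" if "x \<in> X" for x
    using a_le[OF that] by (intro Lim_null_comparison[OF _ d_pointwise[OF that]]) auto
  have s_pointwise: "(\<lambda>k. s k x) \<longlonglongrightarrow> 0" if "x \<in> X" for x
    using tendsto_mult_left_zero[OF a_pointwise[OF that], of "inverse (A x)"]
    by (simp add: s_def divide_inverse)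
  \<comment> \<open>Minimum and maximum are \<open>1\<close>-Lipschitz for the supremum norm of their two arguments.\<close>
  have a_Lipschitz: "\<bar>a k x - a k y\<bar> \<le> cmod (d k x - d k y) + \<bar>A x - A y\<bar>"
    if "x \<in> X" "y \<in> X" for k x y
    using abs_Re_le_cmod[of "d k x - d k y"] by (auto simp: a_def d_at that max_def min_def)
  define f where "f k = (\<lambda>x\<in>X. complex_of_real (1 - s k x) \<odot>\<^bsub>E x\<^esub> u x)" for k
  have fs: "f k \<in> sections X E" for k
    using ux fibre by (auto simp: f_def sections_def intro!: fd_hilbert.smult_in_carrier)
  have error: "difference (f k) u x = complex_of_real (- s k x) \<odot>\<^bsub>E x\<^esub> u x" if x: "x \<in> X" for k x
  proof -
    interpret V: fd_hilbert "E x"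
      by (rule fibre) (rule x)
    have "difference (f k) u x = complex_of_real (1 - s k x) \<odot>\<^bsub>E x\<^esub> u x \<oplus>\<^bsub>E x\<^esub> (- 1) \<odot>\<^bsub>E x\<^esub> u x"
      using x ux[OF x] by (simp add: difference_at f_def V.minus_eq_smult)
    also have "\<dots> = (complex_of_real (1 - s k x) + (- 1)) \<odot>\<^bsub>E x\<^esub> u x"
      using V.smult_l_distr[of "complex_of_real (1 - s k x)" "- 1" "u x"] ux[OF x] by simp
    finally show ?thesis
      by simp
  qed
  have error_norm: "cnorm (E x) (difference (f k) u x) = a k x" if x: "x \<in> X" for k x
    using fd_hilbert.cnorm_scale[OF fibre[OF x] ux[OF x], of "- s k x"] s_bounds(1)[OF x, of k]
      s_A[OF x, of k]
    by (simp add: error[OF x] A_def)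
  have error_s: "difference (f k) u \<in> sections X E" for k
    by (rule difference_in_sections[OF fs us(1)])
  have error_nonneg: "0 \<le> component (difference (f k) u) i" if "i \<in> sites" for k i
    by (rule component_seminorm(1)[OF error_s us(1) that])
  have error_le: "component (difference (f k) u) i \<le> S.component (d k) i + 2 * component u i"
    if i: "i \<in> sites" for k i
    using i
  proof (cases rule: sites_cases)
    case (edge x y)
    let ?\<beta> = "sqrt (b x y / 2)" and ?D = "cnorm (E x) (u x \<ominus>\<^bsub>E x\<^esub> \<Phi> x y (u y))"
    interpret V: fd_hilbert "E x"
      by (rule fibre) (rule edge)
    have \<Phi>u: "\<Phi> x y (u y) \<in> carrier (E x)" "cnorm (E x) (\<Phi> x y (u y)) = A y"
      using edge ux by (simp_all add: transport A_def)
    have "\<Phi> x y (difference (f k) u y) = complex_of_real (- s k y) \<odot>\<^bsub>E x\<^esub> \<Phi> x y (u y)"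
      using transport(1)[of x y] edge ux by (simp add: error linear_between_def)
    then have "cnorm (E x) (difference (f k) u x \<ominus>\<^bsub>E x\<^esub> \<Phi> x y (difference (f k) u y))
        = cnorm (E x) (complex_of_real (- s k x) \<odot>\<^bsub>E x\<^esub> u x
            \<ominus>\<^bsub>E x\<^esub> complex_of_real (- s k y) \<odot>\<^bsub>E x\<^esub> \<Phi> x y (u y))"
      using edge by (simp only: error)
    also have "\<dots> \<le> \<bar>- s k x * cnorm (E x) (u x) - - s k y * cnorm (E x) (\<Phi> x y (u y))\<bar> + ?D"
      by (rule V.cnorm_smult_diff_le)
        (use edge ux \<Phi>u s_bounds in \<open>auto intro: mult_le_one\<close>)
    also have "\<dots> = \<bar>a k x - a k y\<bar> + ?D"
      using edge s_A[of x k] s_A[of y k] by (simp add: \<Phi>u A_def)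
    also have "\<dots> \<le> cmod (d k x - d k y) + \<bar>A x - A y\<bar> + ?D"
      using a_Lipschitz[of x y k] edge by simp
    also have "\<bar>A x - A y\<bar> \<le> ?D"
      using V.cnorm_reverse_triangle[OF ux \<Phi>u(1)] edge \<Phi>u by (simp add: A_def)
    finally have "?\<beta> * cnorm (E x) (difference (f k) u x \<ominus>\<^bsub>E x\<^esub> \<Phi> x y (difference (f k) u y))
        \<le> ?\<beta> * (cmod (d k x - d k y) + ?D + ?D)"
      using edge by (intro mult_left_mono) simp_all
    then show ?thesis
      using edge by (simp add: form_component_def algebra_simps)
  next
    case (vertex x)
    interpret V: positive_operator "E x" "W x"
      by (rule potential) (rule vertex)
    have "component (difference (f k) u) i = s k x * component u i"
      using vertex ux V.gauge_scale[of "u x" "- s k x"] s_bounds(1)[of x k]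
      by (simp add: component_vertex error)
    also have "\<dots> \<le> 1 * component u i"
      using vertex s_bounds component_seminorm(1)[OF us(1) us(1) i] by (intro mult_right_mono) auto
    finally show ?thesis
      using component_seminorm(1)[OF us(1) us(1) i] S.component_seminorm(1)[OF d(1)[of k] Us i]
      by simp
  qed
  have error_pointwise: "(\<lambda>k. component (difference (f k) u) i) \<longlonglongrightarrow> 0" if i: "i \<in> sites" for i
    using i
  proof (cases rule: sites_cases)
    case (edge x y)
    interpret V: fd_hilbert "E x"
      by (rule fibre) (rule edge)
    have "component (difference (f k) u) i \<le> sqrt (b x y / 2) * (a k x + a k y)" for k
    proof -
      have fk: "difference (f k) u x \<in> carrier (E x)" "difference (f k) u y \<in> carrier (E y)"
        using edge error_s by (auto intro: section_in_fibre)
      then have "cnorm (E x) (difference (f k) u x \<ominus>\<^bsub>E x\<^esub> \<Phi> x y (difference (f k) u y)) \<le> a k x + a k y"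
        using V.cnorm_diff_le[of "difference (f k) u x" "\<Phi> x y (difference (f k) u y)"] edge
        by (simp add: transport error_norm)
      then show ?thesis
        using edge by (simp only: component_edge) (rule mult_left_mono)
    qed
    moreover have "(\<lambda>k. sqrt (b x y / 2) * (a k x + a k y)) \<longlonglongrightarrow> sqrt (b x y / 2) * (0 + 0)"
      using edge by (intro tendsto_intros a_pointwise)
    ultimately show ?thesis
      using error_nonneg[OF i]
      by (intro Lim_null_comparison[of "\<lambda>k. component (difference (f k) u) i"
            "\<lambda>k. sqrt (b x y / 2) * (a k x + a k y)"]) auto
  next
    case (vertex x)
    interpret V: positive_operator "E x" "W x"
      by (rule potential) (rule vertex)
    have "component (difference (f k) u) i = s k x * component u i" for k
      using vertex ux V.gauge_scale[of "u x" "- s k x"] s_bounds(1)[of x k]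
      by (simp add: component_vertex error)
    then show ?thesis
      using tendsto_mult_left_zero[OF s_pointwise[OF vertex(2)]] by simp
  qed
  have two: "square_summable sites (\<lambda>i. 2 * component u i)"
    using us(3) by (simp add: square_norm_cmult)
  have form_error: "square_summable sites (component (difference (f k) u))"
    "(\<lambda>k. square_norm sites (component (difference (f k) u))) \<longlonglongrightarrow> 0" for k
  proof -
    note conv = square_norm_perturbed_dominated_convergence[OF two _ d(3) _ d_lim(1)
        error_nonneg error_le error_pointwise]
    have nonneg: "0 \<le> 2 * component u i" "0 \<le> S.component (d k) i" if "i \<in> sites" for i k
      using component_seminorm(1)[OF us(1) us(1) that] S.component_seminorm(1)[OF d(1) Us that]
      by simp_all
    show "square_summable sites (component (difference (f k) u))"
      using nonneg by (intro conv(1)) auto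
    show "(\<lambda>k. square_norm sites (component (difference (f k) u))) \<longlonglongrightarrow> 0"
      using nonneg by (intro conv(2)) auto
  qed
  have mass_le: "mass (difference (f k) u) x \<le> S.mass (d k) x" if "x \<in> X" for k x
    using a_le(3)[OF that, of k] measure_pos[OF that]
    by (simp add: mass_component_def error_norm[OF that])
  have mass_nonneg: "0 \<le> mass (difference (f k) u) x" if "x \<in> X" for k x
    by (rule mass_seminorm(1)[OF error_s us(1) that])
  have mass_error: "square_summable X (mass (difference (f k) u))"
    "square_norm X (mass (difference (f k) u)) \<le> square_norm X (S.mass (d k))" for k
    using square_norm_mono[OF d(2) mass_nonneg mass_le] by blast+
  have mass_lim: "(\<lambda>k. square_norm X (mass (difference (f k) u))) \<longlonglongrightarrow> 0"
    by (rule Lim_null_comparison[OF _ d_lim(2)]) (simp add: mass_error)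
  have f_fin: "f k \<in> fin_sections X E" for k
  proof -
    have "f k x = \<zero>\<^bsub>E x\<^esub>" if x: "x \<in> X" and "\<phi> k x = 0" for x
    proof -
      interpret V: fd_hilbert "E x"
        by (rule fibre) (rule x)
      have a: "a k x = A x"
        using A_nonneg[OF x] \<open>\<phi> k x = 0\<close> by (simp add: a_def)
      show ?thesis
      proof (cases "A x = 0")
        case True
        then have "u x = \<zero>\<^bsub>E x\<^esub>"
          using V.cnorm_eq_0[OF ux[OF x]] by (simp add: A_def)
        then show ?thesis
          using x V.smult_r_null by (simp add: f_def)
      next
        case False
        then show ?thesis
          using x a ux[OF x] V.smult_l_null[of "u x"] by (simp add: f_def s_def)
      qed
    qed
    then have "{x \<in> X. f k x \<noteq> \<zero>\<^bsub>E x\<^esub>} \<subseteq> {x \<in> X. \<phi> k x \<noteq> 0}"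
      by blast
    moreover have "finite {x \<in> X. \<phi> k x \<noteq> 0}"
      using \<phi>_dom[of k] by (simp only: S.dom_restricted_form) (simp add: fin_sections_def)
    ultimately show ?thesis
      using fs finite_subset by (auto simp: fin_sections_def)
  qed
  have "f k \<in> dom restricted_form" for k
    unfolding dom_restricted_form
    using in_dom_neumann_if_difference[OF fs u mass_error(1) form_error(1)] f_fin by blast
  then have "form_approximates X m E restricted_form f u"
    unfolding form_approximates_iff[OF u] using form_error(2) mass_lim by blast
  then show ?thesis
    by blast
qed

end

theorem theorem4p8:
  fixes X :: "'x set" and b :: "'x \<Rightarrow> 'x \<Rightarrow> real" and m c :: "'x \<Rightarrow> real"
    and E :: "'x \<Rightarrow> 'v cinner_space"
    and \<Phi> :: "'x \<Rightarrow> 'x \<Rightarrow> 'v \<Rightarrow> 'v" and W :: "'x \<Rightarrow> 'v \<Rightarrow> 'v"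
  assumes "weighted_graph X b m"
    and "\<forall>x\<in>X. 0 \<le> c x"
    and "hermitian_bundle X E"
    and "unitary_connection X E \<Phi>"
    and "bundle_endomorphism X E W"
    and "pointwise_positive X E W"
    and "bounded_below_by X E W c"
    and "scalar_dirichlet_form X b m c = scalar_neumann_form X b m c"
  shows "dirichlet_form X b m E \<Phi> W = neumann_form X b m E \<Phi> W"
proof -
  have fibre: "fd_hilbert (E x)" if "x \<in> X" for x
    using assms(3) that by (simp add: hermitian_bundle_def)
  have potential: "positive_operator (E x) (W x)" if "x \<in> X" for x
    using fibre assms(5,6) that
    by (intro positive_operator.intro positive_operator_axioms.intro)
      (simp_all add: bundle_endomorphism_def pointwise_positive_def)
  interpret magnetic_bundle X b m E \<Phi> W
    using assms(1,4) fibre potential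
    by (intro magnetic_bundle.intro magnetic_bundle_axioms.intro)
  show ?thesis
    unfolding dirichlet_eq_neumann_iff
    using approximable_if_scalar_forms_agree[OF assms(2,7,8)] by blast
qed

end
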